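(* Let $O,A,B$ be three pairwise distinct points of the Euclidean plane $\mathbb{R}^2$, let $\vec\alpha=\frac{1}{OA}\overrightarrow{AO}$, $\vec\beta=\frac{1}{OB}\overrightarrow{OB}$, let $\Omega\in]-\pi,\pi]$ be the principal determination of the oriented angle from $\vec\alpha$ to $\vec\beta$, and assume $\Omega\in]0,\pi[$. Let $\mathcal{E}$ be the set of curves defined in the context. Then: (1) if $OA=OB$, there exists a unique curve $X$ of $\mathcal{E}$ formed of a circular arc of radius $R_a>0$ and of length belonging to $]0,R_a\pi[$; (2) if $OA\ne OB$, there exists a unique curve $X$ of $\mathcal{E}$ formed of a circular arc of radius $R_a>0$ and of length belonging to $]0,R_a\pi[$ and of a line segment of nonzero length. In both cases the radius $R_a$ of the circle is unique, it depends only on $O$, $A$ and $B$, and $$\big\|\,\|X''\|\,\big\|_{L^\infty(0,L(X))}=\frac{1}{R_a}.$$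
   Context: $\|\cdot\|$ is the Euclidean norm of $\mathbb{R}^2$. Let $\vec k$ be the unit vector obtained by rotating $\vec\alpha$ by $+\pi/2$. Definition of $\mathcal{E}$: the set of all curves $X:[0,L]\to\mathbb{R}^2$, with $L=L(X)>0$ depending on $X$, such that $X\in W^{2,\infty}(0,L;\mathbb{R}^2)$ (hence $X$ is $C^1$ on $[0,L]$), $\|X'(s)\|=1$ for all $s\in[0,L]$, $X(0)=A$, $X(L)=B$, $X'(0)=\vec\alpha$, $X'(L)=\vec\beta$, and such that the angle $\phi$ is nondecreasing on $[0,L]$. Here $\phi:[0,L]\to\mathbb{R}$ is the continuous determination of the oriented angle from $\vec\alpha$ to $X'(s)$, i.e. $X'(s)=\cos\phi(s)\,\vec\alpha+\sin\phi(s)\,\vec k$; equalities of angles are understood strictly and not modulo $2\pi$, so that $\phi(0)=0$, $\phi(L)=\Omega$ and hence $\phi(s)\in[0,\Omega]$ for all $s$. Monotonicity of $\phi$ is equivalent to the signed curvature $c=\phi'$ being nonnegative almost everywhere. The arc and the segment may occur in either order along the curve. *)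

theory Defs
  imports "HOL-Analysis.Analysis" "HOL-Library.FuncSet" "HOL-Probability.Essential_Supremum"
begin

section \<open>Sobolev spaces of order $k$ and exponent $\infty$ on a subset of the line\<close>

definition test_function :: "real set \<Rightarrow> (real \<Rightarrow> real) \<Rightarrow> bool" where
  "test_function I \<eta> \<longleftrightarrow>
     (\<forall>k x. (deriv ^^ k) \<eta> field_differentiable (at x)) \<and>
     compact (closure {x. \<eta> x \<noteq> 0}) \<and> closure {x. \<eta> x \<noteq> 0} \<subseteq> I"

definition locally_integrable :: "real set \<Rightarrow> (real \<Rightarrow> 'a::euclidean_space) \<Rightarrow> bool" where
  "locally_integrable I f \<longleftrightarrow> (\<forall>K\<subseteq>I. compact K \<longrightarrow> f absolutely_integrable_on K)"

text \<open>\<open>g\<close> is a (representative of the) distributional derivative of order \<open>k\<close> of \<open>f\<close> on \<open>I\<close>.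
  Local integrability is required because the Bochner integral is \<open>0\<close> for non-integrable functions.\<close>

definition weak_derivative ::
    "nat \<Rightarrow> real set \<Rightarrow> (real \<Rightarrow> 'a::euclidean_space) \<Rightarrow> (real \<Rightarrow> 'a) \<Rightarrow> bool" where
  "weak_derivative k I f g \<longleftrightarrow>
     locally_integrable I f \<and> locally_integrable I g \<and>
     (\<forall>\<eta>. test_function I \<eta> \<longrightarrow>
        integral\<^sup>L (lebesgue_on I) (\<lambda>s. (deriv ^^ k) \<eta> s *\<^sub>R f s) =
        (-1) ^ k *\<^sub>R integral\<^sup>L (lebesgue_on I) (\<lambda>s. \<eta> s *\<^sub>R g s))"

definition Linf_norm :: "real set \<Rightarrow> (real \<Rightarrow> 'a::euclidean_space) \<Rightarrow> ennreal" where
  "Linf_norm I f = esssup (lebesgue_on I) (\<lambda>s. ennreal (norm (f s)))"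

definition Linf :: "real set \<Rightarrow> (real \<Rightarrow> 'a::euclidean_space) set" where
  "Linf I = {f. f \<in> borel_measurable (lebesgue_on I) \<and> Linf_norm I f < \<infinity>}"

definition W_inf :: "nat \<Rightarrow> real set \<Rightarrow> (real \<Rightarrow> 'a::euclidean_space) set" where
  "W_inf k I = {f \<in> Linf I. \<forall>j\<in>{1..k}. \<exists>g\<in>Linf I. weak_derivative j I f g}"

section \<open>Directions and oriented angles\<close>

text \<open>Rotation by $+\pi/2$.\<close>

definition rot90 :: "real^2 \<Rightarrow> real^2" where
  "rot90 v = vector [- (v $ 2), v $ 1]"

text \<open>Principal determination of the oriented angle from \<open>u\<close> to \<open>v\<close>; meaningful for unit vectors.\<close>

definition oriented_angle :: "real^2 \<Rightarrow> real^2 \<Rightarrow> real" where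
  "oriented_angle u v =
     (THE w. - pi < w \<and> w \<le> pi \<and> v = cos w *\<^sub>R u + sin w *\<^sub>R rot90 u)"

text \<open>\<open>P\<close> denotes the point $O$ (the name \<open>O\<close> is reserved for relation composition).\<close>

definition \<alpha>_dir :: "real^2 \<Rightarrow> real^2 \<Rightarrow> real^2" where
  "\<alpha>_dir P A = (1 / dist P A) *\<^sub>R (P - A)"

definition \<beta>_dir :: "real^2 \<Rightarrow> real^2 \<Rightarrow> real^2" where
  "\<beta>_dir P B = (1 / dist P B) *\<^sub>R (B - P)"

definition \<Omega>_angle :: "real^2 \<Rightarrow> real^2 \<Rightarrow> real^2 \<Rightarrow> real" where
  "\<Omega>_angle P A B = oriented_angle (\<alpha>_dir P A) (\<beta>_dir P B)"

section \<open>The set of admissible curves\<close>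

text \<open>A curve is a pair \<open>(L, X)\<close>; taking \<open>X\<close> extensional makes equality of pairs the equality
  of functions on $[0,L]$.\<close>

type_synonym curve = "real \<times> (real \<Rightarrow> real^2)"

definition velocity :: "curve \<Rightarrow> real \<Rightarrow> real^2" where
  "velocity c s = vector_derivative (snd c) (at s within {0..fst c})"

text \<open>An element of \<open>W_inf 2\<close> is only determined almost everywhere; the \<open>C\<^sup>1\<close> conditions on
  the closed interval select its \<open>C\<^sup>1\<close> representative.\<close>

definition curves :: "real^2 \<Rightarrow> real^2 \<Rightarrow> real^2 \<Rightarrow> curve set" where
  "curves P A B = {(L, X).
     0 < L \<and> X \<in> extensional {0..L} \<and>
     X \<in> W_inf 2 {0<..<L} \<and>
     X differentiable_on {0..L} \<and> continuous_on {0..L} (velocity (L, X)) \<and>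
     (\<forall>s\<in>{0..L}. norm (velocity (L, X) s) = 1) \<and>
     X 0 = A \<and> X L = B \<and>
     velocity (L, X) 0 = \<alpha>_dir P A \<and> velocity (L, X) L = \<beta>_dir P B \<and>
     (\<exists>\<phi>. continuous_on {0..L} \<phi> \<and> \<phi> 0 = 0 \<and> \<phi> L = \<Omega>_angle P A B \<and>
        (\<forall>s\<in>{0..L}. velocity (L, X) s =
           cos (\<phi> s) *\<^sub>R \<alpha>_dir P A + sin (\<phi> s) *\<^sub>R rot90 (\<alpha>_dir P A)) \<and>
        mono_on {0..L} \<phi>)}"

section \<open>Arcs and segments\<close>

text \<open>Both are parametrised by arc length, so that their length is \<open>b - a\<close>.  The sign \<open>\<epsilon>\<close> is
  the sense in which the circle is traversed.\<close>

definition circular_arc_on :: "real \<Rightarrow> real \<Rightarrow> (real \<Rightarrow> real^2) \<Rightarrow> real \<Rightarrow> bool" where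
  "circular_arc_on a b X R \<longleftrightarrow>
     (\<exists>C \<theta>. \<exists>\<epsilon>\<in>{1, -1}. \<forall>s\<in>{a..b}.
        X s = C + R *\<^sub>R vector [cos (\<theta> + \<epsilon> * (s - a) / R), sin (\<theta> + \<epsilon> * (s - a) / R)])"

definition segment_on :: "real \<Rightarrow> real \<Rightarrow> (real \<Rightarrow> real^2) \<Rightarrow> bool" where
  "segment_on a b X \<longleftrightarrow> (\<exists>Q u. norm u = 1 \<and> (\<forall>s\<in>{a..b}. X s = Q + (s - a) *\<^sub>R u))"

definition short_arc_on :: "real \<Rightarrow> real \<Rightarrow> (real \<Rightarrow> real^2) \<Rightarrow> real \<Rightarrow> bool" where
  "short_arc_on a b X R \<longleftrightarrow> 0 < R \<and> b - a \<in> {0<..<R * pi} \<and> circular_arc_on a b X R"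

definition formed_of_arc :: "real \<Rightarrow> curve \<Rightarrow> bool" where
  "formed_of_arc R = (\<lambda>(L, X). short_arc_on 0 L X R)"

definition formed_of_arc_and_segment :: "real \<Rightarrow> curve \<Rightarrow> bool" where
  "formed_of_arc_and_segment R = (\<lambda>(L, X).
     \<exists>m. 0 < m \<and> m < L \<and>
       (short_arc_on 0 m X R \<and> segment_on m L X \<or> segment_on 0 m X \<and> short_arc_on m L X R))"

text \<open>The essential supremum of the norm of the second derivative is \<open>r\<close>, for every representative
  of that derivative; one exists for the elements of \<^const>\<open>curves\<close>.\<close>

definition second_derivative_norm :: "curve \<Rightarrow> real \<Rightarrow> bool" where
  "second_derivative_norm c r \<longleftrightarrow>
     (\<forall>g. weak_derivative 2 {0<..<fst c} (snd c) g \<longrightarrow>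
        Linf_norm {0<..<fst c} g = ennreal r)"

end

theory Submission
  imports Defs
begin

text \<open>Write $a = OA$, $b = OB$, $w = \Omega$. A curve made of an arc and possibly one segment turns
  along its arc only. The arc is shorter than a half circle and has to turn the tangent from
  $\vec\alpha$ to $\vec\beta$, so it is traversed to the left and its length is exactly $R w$
  (\<open>pieces_eq_ramp_curve\<close>). All the admissible shapes are therefore instances of one
  family, \<open>ramp_curve\<close>: a segment of length $p$, an arc of radius $R$ and length $R w$, and a
  segment up to the total length $L$, where either segment may have length $0$. Since such an arc
  displaces its starting point by $R \tan(w/2)\,(\vec\alpha + \vec\beta)$ and
  $B - A = a \vec\alpha + b \vec\beta$ with $\vec\alpha$, $\vec\beta$ independent, the curve ends at
  $B$ if and only if
  \[ p + R \tan(w/2) = a, \qquad R \tan(w/2) + (L - p - R w) = b. \]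
  When at most one of the two segments is nontrivial, these equations say that
  $R \tan(w/2) = \min(a,b)$ and that the segment, placed first if $a > b$ and last if $a < b$, has
  length $|a - b|$ (\<open>canonical_curve\<close>).

  The second derivative of such a curve, taken piecewise, has norm $1/R$ on the arc and $0$ on the
  segments. Integration by parts shows that it is a weak derivative
  (\<open>weak_derivatives_piecewise_C2\<close>), which gives membership in $W^{2,\infty}$. The norm
  statement concerns every weak second derivative, so it also needs their uniqueness almost
  everywhere (\<open>weak_derivative_unique\<close>). For that, smooth bumps increasing to the indicator of
  an interval show that a function annihilated by all test functions has integral $0$ over every
  compact interval, and Lebesgue differentiation concludes.\<close>

section \<open>Smooth bump functions\<close>

text \<open>Smoothness is proved by exhibiting a set of functions that is stable under differentiation.\<close>

lemma iterated_deriv_closed: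
  fixes S :: "(real \<Rightarrow> real) set"
  assumes step: "\<And>f. f \<in> S \<Longrightarrow> \<exists>g\<in>S. \<forall>x. (f has_real_derivative g x) (at x)"
    and f: "f \<in> S"
  shows "(deriv ^^ k) f \<in> S" "(deriv ^^ k) f field_differentiable (at x)"
proof -
  show *: "(deriv ^^ k) f \<in> S" for k
  proof (induction k)
    case (Suc k)
    obtain g where "g \<in> S" "\<forall>x. ((deriv ^^ k) f has_real_derivative g x) (at x)"
      using step[OF Suc] by blast
    moreover from this have "deriv ((deriv ^^ k) f) = g"
      by (auto intro!: ext DERIV_imp_deriv)
    ultimately show ?case by simp
  qed (simp add: f)
  show "(deriv ^^ k) f field_differentiable (at x)"
    using step[OF *[of k]] by (auto simp: field_differentiable_def)
qed

text \<open>The functions $e^{-t/x} x^{-i}$ on $x > 0$, extended by $0$. For fixed $t > 0$ their linear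
  combinations are differentiable everywhere, also at the origin, with derivatives of the same kind.\<close>

definition flat :: "real \<Rightarrow> nat \<Rightarrow> real \<Rightarrow> real" where
  "flat t i x = (if 0 < x then exp (- (t * inverse x)) * inverse x ^ i else 0)"

lemma power_div_fact_le_exp:
  fixes z :: real
  assumes "0 \<le> z"
  shows "z ^ n / fact n \<le> exp z"
proof -
  have "(\<Sum>k\<in>{n}. z ^ k /\<^sub>R fact k) \<le> (\<Sum>k. z ^ k /\<^sub>R fact k)"
    by (rule sum_le_suminf) (use assms summable_exp_generic[of z] in auto)
  then show ?thesis
    by (simp add: exp_def divide_inverse mult.commute)
qed

lemma flat_le_square:
  assumes "0 < t"
  shows "\<bar>flat t i x\<bar> \<le> fact (i + 2) / t ^ (i + 2) * x\<^sup>2"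
proof (cases "0 < x")
  case True
  have "(t * inverse x) ^ (i + 2) / fact (i + 2) \<le> exp (t * inverse x)"
    using True assms by (intro power_div_fact_le_exp) simp
  then have "exp (- (t * inverse x)) \<le> inverse ((t * inverse x) ^ (i + 2) / fact (i + 2))"
    using True assms by (simp only: exp_minus) (intro le_imp_inverse_le, auto)
  also have "\<dots> = fact (i + 2) / t ^ (i + 2) * x ^ (i + 2)"
    using True by (simp add: power_mult_distrib power_inverse divide_inverse)
  finally have "exp (- (t * inverse x)) * inverse x ^ i
      \<le> fact (i + 2) / t ^ (i + 2) * x ^ (i + 2) * inverse x ^ i"
    using True by (intro mult_right_mono) auto
  also have "\<dots> = fact (i + 2) / t ^ (i + 2) * x\<^sup>2 * (x * inverse x) ^ i"
    by (simp only: power_mult_distrib power_add mult_ac)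
  finally show ?thesis
    using True by (simp add: flat_def)
qed (use assms in \<open>simp add: flat_def\<close>)

lemma DERIV_flat:
  assumes "0 < t"
  shows "(flat t i has_real_derivative (- real i * flat t (i + 1) x + t * flat t (i + 2) x)) (at x)"
proof -
  consider "x < 0" | "x = 0" | "0 < x" by linarith
  then show ?thesis
  proof cases
    case 1
    have "((\<lambda>x. 0) has_real_derivative 0) (at x)" by simp
    then have "(flat t i has_real_derivative 0) (at x)"
      by (rule has_field_derivative_transform_within_open[of _ _ _ "{..<0}"]) (use 1 in \<open>auto simp: flat_def\<close>)
    then show ?thesis using 1 by (simp add: flat_def)
  next
    case 2
    have "(\<lambda>h. flat t i h / h) \<midarrow>0\<rightarrow> 0"
    proof (rule Lim_null_comparison)
      show "\<forall>\<^sub>F h in at 0. norm (flat t i h / h) \<le> fact (i + 2) / t ^ (i + 2) * \<bar>h\<bar>"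
      proof (rule eventually_at_filter[THEN iffD2, OF always_eventually], intro allI impI)
        fix h :: real assume "h \<noteq> 0"
        then have "\<bar>flat t i h\<bar> / \<bar>h\<bar> \<le> fact (i + 2) / t ^ (i + 2) * h\<^sup>2 / \<bar>h\<bar>"
          using flat_le_square[OF assms] by (intro divide_right_mono) auto
        also have "\<dots> = fact (i + 2) / t ^ (i + 2) * \<bar>h\<bar>"
          using \<open>h \<noteq> 0\<close> by (simp add: power2_eq_square abs_if)
        finally show "norm (flat t i h / h) \<le> fact (i + 2) / t ^ (i + 2) * \<bar>h\<bar>" by simp
      qed
      show "((\<lambda>h. fact (i + 2) / t ^ (i + 2) * \<bar>h\<bar>) \<longlongrightarrow> 0) (at 0)"
        by (rule tendsto_eq_intros refl | simp)+
    qed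
    then show ?thesis using 2 by (simp add: flat_def DERIV_def)
  next
    case 3
    let ?y = "inverse x"
    have "((\<lambda>x. exp (- (t * inverse x)) * inverse x ^ i) has_real_derivative
        (exp (- (t * ?y)) * (t * ?y\<^sup>2)) * ?y ^ i
        + exp (- (t * ?y)) * (real i * ?y ^ (i - 1) * (- ?y\<^sup>2))) (at x)"
      using 3 by (auto intro!: derivative_eq_intros simp: power2_eq_square)
    moreover have "real i * ?y ^ (i - 1) * (- ?y\<^sup>2) = - real i * ?y ^ (i + 1)"
      by (cases i) (auto simp: power2_eq_square algebra_simps)
    then have "(exp (- (t * ?y)) * (t * ?y\<^sup>2)) * ?y ^ i
        + exp (- (t * ?y)) * (real i * ?y ^ (i - 1) * (- ?y\<^sup>2))
      = - real i * flat t (i + 1) x + t * flat t (i + 2) x"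
      using 3 by (simp only:) (simp add: flat_def algebra_simps power_add power2_eq_square)
    ultimately have "((\<lambda>x. exp (- (t * inverse x)) * inverse x ^ i) has_real_derivative
        (- real i * flat t (i + 1) x + t * flat t (i + 2) x)) (at x)"
      by simp
    then show ?thesis
      by (rule has_field_derivative_transform_within_open[of _ _ _ "{0<..}"]) (use 3 in \<open>auto simp: flat_def\<close>)
  qed
qed

text \<open>The linear span of the products \<open>flat t i (x - a) * flat t j (b - x)\<close>, a space of functions
  that vanish outside $]a,b[$. For $t > 0$ it is stable under differentiation.\<close>

inductive_set bump_span :: "real \<Rightarrow> real \<Rightarrow> real \<Rightarrow> (real \<Rightarrow> real) set" for t a b where
  base: "(\<lambda>x. flat t i (x - a) * flat t j (b - x)) \<in> bump_span t a b"
| add: "f \<in> bump_span t a b \<Longrightarrow> g \<in> bump_span t a b \<Longrightarrow> (\<lambda>x. f x + g x) \<in> bump_span t a b"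
| scale: "f \<in> bump_span t a b \<Longrightarrow> (\<lambda>x. c * f x) \<in> bump_span t a b"

lemma bump_span_deriv:
  assumes "0 < t" "f \<in> bump_span t a b"
  shows "\<exists>g\<in>bump_span t a b. \<forall>x. (f has_real_derivative g x) (at x)"
  using assms(2)
proof induction
  case (base i j)
  let ?F = "\<lambda>i j x. flat t i (x - a) * flat t j (b - x)"
  let ?g = "\<lambda>x. (- real i * ?F (i + 1) j x + t * ?F (i + 2) j x)
                 + (real j * ?F i (j + 1) x + (- t) * ?F i (j + 2) x)"
  have S: "?g \<in> bump_span t a b"
    by (rule bump_span.add, rule bump_span.add, (rule bump_span.scale, rule bump_span.base)+,
        rule bump_span.add, (rule bump_span.scale, rule bump_span.base)+)
  have D: "\<forall>x. (?F i j has_real_derivative ?g x) (at x)"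
  proof
    fix x
    have 1: "((\<lambda>x. flat t i (x - a)) has_real_derivative
        (- real i * flat t (i + 1) (x - a) + t * flat t (i + 2) (x - a)) * 1) (at x)"
      by (rule DERIV_chain2[OF DERIV_flat[OF assms(1)]]) (auto intro!: derivative_eq_intros)
    have 2: "((\<lambda>x. flat t j (b - x)) has_real_derivative
        (- real j * flat t (j + 1) (b - x) + t * flat t (j + 2) (b - x)) * (-1)) (at x)"
      by (rule DERIV_chain2[OF DERIV_flat[OF assms(1)]]) (auto intro!: derivative_eq_intros)
    show "(?F i j has_real_derivative ?g x) (at x)"
      by (rule DERIV_cong[OF DERIV_mult[OF 1 2]]) (simp add: algebra_simps)
  qed
  show ?case
    by (rule bexI[where x="?g"], rule D, rule S)
next
  case (add f g)
  obtain f' where f': "f' \<in> bump_span t a b" "\<forall>x. (f has_real_derivative f' x) (at x)"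
    using add.IH(1) by (rule bexE)
  obtain g' where g': "g' \<in> bump_span t a b" "\<forall>x. (g has_real_derivative g' x) (at x)"
    using add.IH(2) by (rule bexE)
  show ?case
    using DERIV_add[OF f'(2)[rule_format] g'(2)[rule_format]]
    by (intro bexI[of _ "\<lambda>x. f' x + g' x"] bump_span.add f' g' allI)
next
  case (scale f c)
  obtain f' where f': "f' \<in> bump_span t a b" "\<forall>x. (f has_real_derivative f' x) (at x)"
    using scale.IH by (rule bexE)
  show ?case
    using DERIV_cmult[OF f'(2)[rule_format]]
    by (intro bexI[of _ "\<lambda>x. c * f' x"] bump_span.scale f' allI)
qed

text \<open>A smooth function that is positive exactly on $]a,b[$, is for $t > 0$ at most $1$, and increases to
  the indicator function of $]a,b[$ as $t$ decreases to $0$.\<close>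

definition bump :: "real \<Rightarrow> real \<Rightarrow> real \<Rightarrow> real \<Rightarrow> real" where
  "bump t a b x = flat t 0 (x - a) * flat t 0 (b - x)"

lemma bump_eq:
  "bump t a b x = (if a < x \<and> x < b then exp (- (t * (1 / (x - a) + 1 / (b - x)))) else 0)"
  by (auto simp: bump_def flat_def ring_distribs divide_inverse simp flip: exp_add)

lemma test_function_bump:
  assumes "0 < t" "{a..b} \<subseteq> I" "a < b"
  shows "test_function I (bump t a b)"
proof -
  have S: "bump t a b \<in> bump_span t a b"
    unfolding bump_def by (rule bump_span.base)
  have "{x. bump t a b x \<noteq> 0} = {a<..<b}"
    by (auto simp: bump_eq)
  then show ?thesis
    using iterated_deriv_closed(2)[OF bump_span_deriv[OF assms(1)] S] assms
    by (simp add: test_function_def)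
qed

lemma test_function_continuous: "test_function I \<eta> \<Longrightarrow> continuous_on A \<eta>"
  by (rule continuous_on_subset[OF _ subset_UNIV], rule continuous_at_imp_continuous_on)
    (auto simp: test_function_def dest!: spec[of _ "0 :: nat"] intro: field_differentiable_imp_continuous_at)

lemma test_function_deriv: "test_function I \<eta> \<Longrightarrow> test_function I (deriv \<eta>)"
  (is "?lhs \<Longrightarrow> _")
proof -
  assume \<eta>: ?lhs
  let ?K = "closure {x. \<eta> x \<noteq> 0}"
  have "deriv \<eta> x = 0" if "x \<notin> ?K" for x
  proof -
    have "((\<lambda>x. 0) has_real_derivative 0) (at x)" by simp
    then have "(\<eta> has_real_derivative 0) (at x)"
      by (rule has_field_derivative_transform_within_open[of _ _ _ "- ?K"])
        (use that closure_subset[of "{x. \<eta> x \<noteq> 0}"] in auto)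
    then show ?thesis by (rule DERIV_imp_deriv)
  qed
  then have "closure {x. deriv \<eta> x \<noteq> 0} \<subseteq> ?K"
    by (intro closure_minimal) auto
  moreover have "compact ?K" "?K \<subseteq> I"
    using \<eta> by (auto simp: test_function_def)
  moreover have "(deriv ^^ k) (deriv \<eta>) field_differentiable (at x)" for k x
  proof -
    have "(deriv ^^ Suc k) \<eta> field_differentiable (at x)"
      using \<eta> unfolding test_function_def by blast
    then show ?thesis by (simp only: funpow_Suc_right o_apply)
  qed
  ultimately show ?thesis
    unfolding test_function_def using compact_closure bounded_subset compact_imp_bounded
    by (metis bounded_closure closure_subset order_trans)
qed

lemma test_function_has_deriv: "test_function I \<eta> \<Longrightarrow> (\<eta> has_vector_derivative deriv \<eta> x) (at x)"
  using field_differentiable_derivI[of \<eta> x]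
  by (auto simp: test_function_def has_real_derivative_iff_has_vector_derivative dest!: spec[of _ "0 :: nat"])

lemma test_function_zero: "test_function I \<eta> \<Longrightarrow> x \<notin> I \<Longrightarrow> \<eta> x = 0"
  unfolding test_function_def using closure_subset[of "{x. \<eta> x \<noteq> 0}"] by auto

section \<open>Uniqueness and existence of weak derivatives\<close>

lemma locally_integrable_diff:
  "locally_integrable I f \<Longrightarrow> locally_integrable I g \<Longrightarrow> locally_integrable I (\<lambda>x. f x - g x)"
  unfolding locally_integrable_def by (blast intro: set_integral_diff(1))

lemma locally_integrable_bounded:
  assumes f: "f \<in> borel_measurable (lebesgue_on I)" and C: "\<And>x. x \<in> I \<Longrightarrow> norm (f x) \<le> C"
  shows "locally_integrable I f"
  unfolding locally_integrable_def
proof (intro allI impI)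
  fix K assume K: "K \<subseteq> I" "compact K"
  then have [simp]: "K \<in> lmeasurable" by (simp add: lmeasurable_compact)
  show "f absolutely_integrable_on K"
    by (rule measurable_bounded_by_integrable_imp_absolutely_integrable[where g = "\<lambda>_. C"])
      (use K C measurable_restrict_mono[OF f K(1)] in
        \<open>auto intro: fmeasurableD integrable_on_const\<close>)
qed

lemma absolutely_integrable_test_mult:
  fixes f :: "real \<Rightarrow> 'a::euclidean_space"
  assumes f: "locally_integrable I f" and \<eta>: "test_function I \<eta>"
  shows "(\<lambda>x. \<eta> x *\<^sub>R f x) absolutely_integrable_on I"
proof -
  let ?K = "closure {x. \<eta> x \<noteq> 0}"
  have K: "compact ?K" "?K \<subseteq> I" using \<eta> by (auto simp: test_function_def)
  have "(\<lambda>x. \<eta> x *\<^sub>R f x) absolutely_integrable_on ?K"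
  proof (rule absolutely_integrable_bounded_measurable_product[where h = "(*\<^sub>R)"])
    show "bilinear ((*\<^sub>R) :: real \<Rightarrow> 'a \<Rightarrow> 'a)"
      by (simp add: bilinear_conv_bounded_bilinear bounded_bilinear_scaleR)
    show "\<eta> \<in> borel_measurable (lebesgue_on ?K)"
      by (intro continuous_imp_measurable_on_sets_lebesgue test_function_continuous[OF \<eta>]) simp
    show "bounded (\<eta> ` ?K)"
      by (intro compact_imp_bounded compact_continuous_image test_function_continuous[OF \<eta>] K)
    show "f absolutely_integrable_on ?K"
      using f K by (simp add: locally_integrable_def)
  qed simp
  moreover have "(\<lambda>x. indicat_real I x *\<^sub>R \<eta> x *\<^sub>R f x) = (\<lambda>x. indicat_real ?K x *\<^sub>R \<eta> x *\<^sub>R f x)"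
    using K(2) closure_subset[of "{x. \<eta> x \<noteq> 0}"] by (auto simp: indicator_def fun_eq_iff)
  ultimately show ?thesis
    by (simp add: set_integrable_def)
qed

lemma lebesgue_integral_test_mult:
  assumes "locally_integrable {a<..<b} f" "test_function {a<..<b} \<eta>"
  shows "integral\<^sup>L (lebesgue_on {a<..<b}) (\<lambda>x. \<eta> x *\<^sub>R f x) = integral {a<..<b} (\<lambda>x. \<eta> x *\<^sub>R f x)"
  using absolutely_integrable_test_mult[OF assms]
  by (intro lebesgue_integral_eq_integral) (simp_all add: integrable_restrict_space set_integrable_def)

text \<open>Dominated convergence along \<open>bump t a b\<close> for $t = 1/(n+1)$.\<close>

lemma integral_zero_of_test_functions:
  fixes f :: "real \<Rightarrow> 'a::euclidean_space"
  assumes f: "locally_integrable I f"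
    and zero: "\<And>\<eta>. test_function I \<eta> \<Longrightarrow> integral I (\<lambda>x. \<eta> x *\<^sub>R f x) = 0"
    and ab: "a < b" "{a..b} \<subseteq> I"
  shows "integral {a..b} f = 0"
proof -
  let ?t = "\<lambda>n. inverse (real (Suc n))"
  let ?h = "\<lambda>n x. bump (?t n) a b x *\<^sub>R f x"
  have test: "test_function I (bump (?t n) a b)" for n
    by (rule test_function_bump) (use ab in auto)
  have eq: "?h n = (\<lambda>x. if x \<in> {a<..<b} then ?h n x else 0)" for n
    by (auto simp: bump_eq)
  have sub: "{a<..<b} \<subseteq> I" using ab(2) by auto
  have "f absolutely_integrable_on {a..b}"
    using f ab(2) by (auto simp: locally_integrable_def)
  then have f_ab: "f integrable_on {a<..<b}" "(\<lambda>x. norm (f x)) integrable_on {a<..<b}"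
    using integrable_on_open_interval[of _ a b]
    by (auto simp: absolutely_integrable_on_def)
  have "?h n integrable_on I" for n
    using absolutely_integrable_test_mult[OF f test] by (simp add: absolutely_integrable_on_def)
  then have "(?h n has_integral 0) I" for n
    using integrable_integral[of "?h n" I] zero[OF test, of n] by simp
  then have "((\<lambda>x. if x \<in> {a<..<b} then ?h n x else 0) has_integral 0) I" for n
    by (simp only: eq[symmetric])
  then have int: "(?h n has_integral 0) {a<..<b}" for n
    by (simp only: has_integral_restrict[OF sub])
  have "(\<lambda>n. integral {a<..<b} (?h n)) \<longlonglongrightarrow> integral {a<..<b} f"
  proof (rule dominated_convergence(2)[OF _ f_ab(2)])
    show "?h n integrable_on {a<..<b}" for n using int by blast
    show "norm (?h n x) \<le> norm (f x)" if "x \<in> {a<..<b}" for n x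
      using that by (auto simp: bump_eq intro!: mult_left_le_one_le)
    show "(\<lambda>n. ?h n x) \<longlonglongrightarrow> f x" if "x \<in> {a<..<b}" for x
    proof -
      let ?c = "1 / (x - a) + 1 / (b - x)"
      have "(\<lambda>n. exp (- (?t n * ?c)) *\<^sub>R f x) \<longlonglongrightarrow> exp (- (0 * ?c)) *\<^sub>R f x"
        by (intro tendsto_intros LIMSEQ_inverse_real_of_nat)
      then show ?thesis using that by (simp add: bump_eq)
    qed
  qed
  moreover have "integral {a<..<b} (?h n) = 0" for n
    using int by (rule integral_unique)
  ultimately have "integral {a<..<b} f = 0"
    by (simp only: LIMSEQ_const_iff)
  then show ?thesis by (simp add: integral_open_interval_real)
qed

text \<open>The fundamental lemma of the calculus of variations. Almost every point $x$ is a Lebesgue point, so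
  $f(x)$ is the limit of the means of $f$ over $[x, x+h]$, all of which vanish.\<close>

lemma AE_zero_of_test_functions:
  fixes f :: "real \<Rightarrow> 'a::euclidean_space"
  assumes f: "locally_integrable {a<..<b} f"
    and zero: "\<And>\<eta>. test_function {a<..<b} \<eta> \<Longrightarrow> integral {a<..<b} (\<lambda>x. \<eta> x *\<^sub>R f x) = 0"
  shows "AE x in lebesgue_on {a<..<b}. f x = 0"
proof -
  have *: "AE x in lebesgue. x \<in> {c<..<d} \<longrightarrow> f x = 0" if cd: "{c..d} \<subseteq> {a<..<b}" for c d
  proof -
    let ?F = "\<lambda>x. if x \<in> {c..d} then f x else 0"
    have "f absolutely_integrable_on {c..d}"
      using f cd by (auto simp: locally_integrable_def)
    then have "?F absolutely_integrable_on UNIV"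
      by (subst absolutely_integrable_restrict_UNIV)
    then have int: "?F integrable_on cbox u v" for u v
      using integrable_on_subcbox[of ?F UNIV u v] by (simp add: absolutely_integrable_on_def)
    obtain N where N: "negligible N" and lim: "\<And>x e. \<lbrakk>x \<notin> N; 0 < e\<rbrakk> \<Longrightarrow>
        \<exists>\<delta>>0. \<forall>h. 0 < h \<and> h < \<delta> \<longrightarrow>
          norm (integral (cbox x (x + h *\<^sub>R One)) ?F /\<^sub>R h ^ DIM(real) - ?F x) < e"
      by (rule integrable_ccontinuous_explicit[of ?F, OF int]; rule that; assumption)
    have "f x = 0" if xN: "x \<notin> N" and x: "x \<in> {c<..<d}" for x
    proof (rule ccontr)
      assume "f x \<noteq> 0"
      then obtain \<delta> where \<delta>: "\<delta> > 0" "\<And>h. 0 < h \<Longrightarrow> h < \<delta> \<Longrightarrow>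
          norm (integral {x..x + h} ?F /\<^sub>R h - ?F x) < norm (f x)"
        using lim[OF xN, of "norm (f x)"] by auto
      define h where "h = min (\<delta> / 2) (d - x)"
      have h: "0 < h" "h < \<delta>" "{x..x + h} \<subseteq> {c..d}"
        using x \<delta>(1) by (auto simp: h_def)
      have "integral {x..x + h} ?F = integral {x..x + h} f"
        by (rule integral_cong) (use h(3) in auto)
      also have "\<dots> = 0"
        by (rule integral_zero_of_test_functions[OF f zero]) (use h cd in auto)
      finally show False using \<delta>(2)[OF h(1,2)] x by simp
    qed
    then show ?thesis
      using N by (auto simp: negligible_iff_null_sets intro: AE_I'[of N])
  qed
  \<comment> \<open>$]a,b[$ is exhausted by countably many intervals with closure in $]a,b[$.\<close>
  let ?J = "\<lambda>n. {a + inverse (real (Suc n)) <..< b - inverse (real (Suc n))}"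
  have "AE x in lebesgue. \<forall>n. x \<in> ?J n \<longrightarrow> f x = 0"
    unfolding AE_all_countable
  proof (intro allI *)
    fix n
    have "0 < inverse (real (Suc n))" by simp
    then show "{a + inverse (real (Suc n))..b - inverse (real (Suc n))} \<subseteq> {a<..<b}"
      by (intro subsetI) (simp only: atLeastAtMost_iff greaterThanLessThan_iff, linarith)
  qed
  then have "AE x in lebesgue. x \<in> {a<..<b} \<longrightarrow> f x = 0"
  proof eventually_elim
    case (elim x)
    show ?case
    proof
      assume "x \<in> {a<..<b}"
      then obtain n where "inverse (real (Suc n)) < min (x - a) (b - x)"
        using reals_Archimedean[of "min (x - a) (b - x)"] by auto
      then show "f x = 0" using elim[rule_format, of n] by auto
    qed
  qed
  then show ?thesis by (subst AE_restrict_space_iff) auto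
qed

lemma weak_derivative_unique:
  assumes "weak_derivative k {a<..<b} f g" "weak_derivative k {a<..<b} f g'"
  shows "AE x in lebesgue_on {a<..<b}. g x = g' x"
proof -
  have g: "locally_integrable {a<..<b} g" "locally_integrable {a<..<b} g'"
    using assms by (auto simp: weak_derivative_def)
  have "AE x in lebesgue_on {a<..<b}. g x - g' x = 0"
  proof (rule AE_zero_of_test_functions[OF locally_integrable_diff[OF g]])
    fix \<eta> assume \<eta>: "test_function {a<..<b} \<eta>"
    note int = absolutely_integrable_test_mult[OF g(1) \<eta>] absolutely_integrable_test_mult[OF g(2) \<eta>]
    have "((-1::real) ^ k) *\<^sub>R integral {a<..<b} (\<lambda>x. \<eta> x *\<^sub>R g x)
        = ((-1) ^ k) *\<^sub>R integral {a<..<b} (\<lambda>x. \<eta> x *\<^sub>R g' x)"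
      using assms \<eta> g by (simp add: weak_derivative_def lebesgue_integral_test_mult)
    then show "integral {a<..<b} (\<lambda>x. \<eta> x *\<^sub>R (g x - g' x)) = 0"
      using int by (simp add: scaleR_diff_right integral_diff absolutely_integrable_on_def)
  qed
  then show ?thesis by simp
qed

text \<open>Only one of the two functions is assumed measurable: Lebesgue measure is complete, so the other one
  is measurable too. This matters because the essential supremum of a non-measurable function is
  $\infty$ by convention.\<close>

lemma Linf_norm_cong_AE:
  fixes f g :: "real \<Rightarrow> 'a::euclidean_space"
  assumes f: "f \<in> borel_measurable (lebesgue_on I)" and I: "I \<in> sets lebesgue"
    and eq: "AE x in lebesgue_on I. f x = g x"
  shows "Linf_norm I g = Linf_norm I f"
proof -
  have "AE x in lebesgue. x \<in> I \<longrightarrow> f x = g x"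
    using eq I by (subst (asm) AE_restrict_space_iff) auto
  then have "AE x in lebesgue. (if x \<in> I then f x else 0) = (if x \<in> I then g x else 0)"
    by eventually_elim auto
  from borel_measurable_AE[OF borel_measurable_if_I[OF f I] this]
  have g: "g \<in> borel_measurable (lebesgue_on I)"
    by (rule borel_measurable_if_D)
  have "AE x in lebesgue_on I. ennreal (norm (g x)) = ennreal (norm (f x))"
    using eq by eventually_elim simp
  then show ?thesis
    unfolding Linf_norm_def
    by (intro esssup_AE_cong measurable_compose[OF f] measurable_compose[OF g]) measurable
qed

text \<open>Integration by parts against a test function, for a continuous function that is differentiable
  except at finitely many points. The boundary terms vanish with the test function.\<close>

lemma weak_derivative_one_step:
  fixes F F' :: "real \<Rightarrow> 'a::euclidean_space"
  assumes \<eta>: "test_function {a<..<b} \<eta>" and ab: "a < b" and S: "finite S"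
    and F: "continuous_on {a..b} F"
    and deriv: "\<And>x. x \<in> {a<..<b} - S \<Longrightarrow> (F has_vector_derivative F' x) (at x)"
    and loc: "locally_integrable {a<..<b} F" "locally_integrable {a<..<b} F'"
  shows "integral\<^sup>L (lebesgue_on {a<..<b}) (\<lambda>x. deriv \<eta> x *\<^sub>R F x)
       = - integral\<^sup>L (lebesgue_on {a<..<b}) (\<lambda>x. \<eta> x *\<^sub>R F' x)"
proof -
  have [simp]: "\<eta> a = 0" "\<eta> b = 0"
    using test_function_zero[OF \<eta>] by auto
  let ?I = "integral {a<..<b} (\<lambda>x. \<eta> x *\<^sub>R F' x)"
  have "((\<lambda>x. \<eta> x *\<^sub>R F' x) has_integral ?I) {a..b}"
    using absolutely_integrable_test_mult[OF loc(2) \<eta>]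
    by (simp add: has_integral_Icc_iff_Ioo absolutely_integrable_on_def integrable_integral)
  then have "((\<lambda>x. deriv \<eta> x *\<^sub>R F x) has_integral - ?I) {a..b}"
    using ab
    by (intro integration_by_parts_interior_strong[OF bounded_bilinear_scaleR S _
          test_function_continuous[OF \<eta>] F test_function_has_deriv[OF \<eta>] deriv]) auto
  then have "integral {a<..<b} (\<lambda>x. deriv \<eta> x *\<^sub>R F x) = - ?I"
    by (simp add: has_integral_Icc_iff_Ioo integral_unique)
  then show ?thesis
    using loc \<eta> by (simp add: lebesgue_integral_test_mult test_function_deriv)
qed

lemma weak_derivatives_piecewise_C2:
  fixes X V G :: "real \<Rightarrow> 'a::euclidean_space"
  assumes ab: "a < b" and S: "finite S"
    and X: "\<And>x. x \<in> {a..b} \<Longrightarrow> (X has_vector_derivative V x) (at x within {a..b})"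
    and V: "continuous_on {a..b} V"
    and G: "\<And>x. x \<in> {a<..<b} - S \<Longrightarrow> (V has_vector_derivative G x) (at x)"
    and Gm: "G \<in> borel_measurable (lebesgue_on {a<..<b})" "\<And>x. x \<in> {a<..<b} \<Longrightarrow> norm (G x) \<le> C"
  shows "weak_derivative 1 {a<..<b} X V" "weak_derivative 2 {a<..<b} X G"
proof -
  have Xc: "continuous_on {a..b} X"
    using X by (rule continuous_on_vector_derivative)
  have loc: "locally_integrable {a<..<b} f" if f: "continuous_on {a..b} f" for f :: "real \<Rightarrow> 'a"
  proof -
    have "bounded (f ` {a..b})"
      by (intro compact_imp_bounded compact_continuous_image f) simp
    then obtain B where B: "\<forall>x\<in>{a..b}. norm (f x) \<le> B"
      by (auto simp: bounded_iff)
    show ?thesis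
      by (rule locally_integrable_bounded[where C = B], rule continuous_imp_measurable_on_sets_lebesgue)
        (use B continuous_on_subset[OF f greaterThanLessThan_subseteq_atLeastAtMost_iff[THEN iffD2]] in auto)
  qed
  have locG: "locally_integrable {a<..<b} G"
    by (rule locally_integrable_bounded[OF Gm])
  have X': "(X has_vector_derivative V x) (at x)" if "x \<in> {a<..<b} - {}" for x
    using X[of x] that by (auto simp: at_within_Icc_at)
  note step1 = weak_derivative_one_step[OF _ ab finite.emptyI Xc X' loc[OF Xc] loc[OF V]]
  note step2 = weak_derivative_one_step[OF _ ab S V G loc[OF V] locG]
  show "weak_derivative 1 {a<..<b} X V"
    using step1 loc[OF Xc] loc[OF V] by (simp add: weak_derivative_def)
  show "weak_derivative 2 {a<..<b} X G"
    using step1[OF test_function_deriv] step2 loc[OF Xc] locG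
    by (simp add: weak_derivative_def numeral_2_eq_2)
qed

section \<open>Rotations of the plane\<close>

text \<open>The vector \<open>u\<close> rotated by the angle \<open>t\<close>.\<close>

definition turned :: "real^2 \<Rightarrow> real \<Rightarrow> real^2" where
  "turned u t = cos t *\<^sub>R u + sin t *\<^sub>R rot90 u"

lemma rot90_simps [simp]: "rot90 u $ 1 = - (u $ 2)" "rot90 u $ 2 = u $ 1"
  by (simp_all add: rot90_def)

lemma turned_nth: "turned u t $ 1 = cos t * u $ 1 - sin t * u $ 2"
  "turned u t $ 2 = cos t * u $ 2 + sin t * u $ 1"
  by (simp_all add: turned_def)

lemma norm_eq_1_iff_components: "norm (u :: real^2) = 1 \<longleftrightarrow> (u $ 1)\<^sup>2 + (u $ 2)\<^sup>2 = 1"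
  by (simp add: norm_vec_def L2_set_def sum_2)

lemma turned_0 [simp]: "turned u 0 = u"
  by (simp add: turned_def)

lemma turned_turned: "turned (turned u s) t = turned u (s + t)"
  by (simp add: vec_eq_iff forall_2 turned_nth cos_add sin_add algebra_simps)

lemma norm_turned [simp]: "norm (turned u t) = norm u"
proof -
  have "(cos t * a - sin t * b)\<^sup>2 + (cos t * b + sin t * a)\<^sup>2 = (a\<^sup>2 + b\<^sup>2) * ((cos t)\<^sup>2 + (sin t)\<^sup>2)"
    for a b by algebra
  then show ?thesis
    by (simp add: norm_vec_def L2_set_def sum_2 turned_nth)
qed

lemma turned_eq_iff:
  assumes "norm u = 1"
  shows "turned u s = turned u t \<longleftrightarrow> cos s = cos t \<and> sin s = sin t"
proof
  assume eq: "turned u s = turned u t"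
  have n: "(u $ 1)\<^sup>2 + (u $ 2)\<^sup>2 = 1" using assms by (simp add: norm_eq_1_iff_components)
  have c: "cos r = turned u r $ 1 * u $ 1 + turned u r $ 2 * u $ 2"
    and s: "sin r = turned u r $ 2 * u $ 1 - turned u r $ 1 * u $ 2" for r
    using arg_cong[OF n, of "\<lambda>x. cos r * x"] arg_cong[OF n, of "\<lambda>x. sin r * x"]
    by (simp_all add: turned_nth power2_eq_square algebra_simps)
  show "cos s = cos t \<and> sin s = sin t"
    using eq c s by metis
qed (simp add: turned_def)

lemma turned_range:
  assumes "norm u = 1" "norm v = 1"
  shows "\<exists>t. v = turned u t"
proof -
  let ?c = "v $ 1 * u $ 1 + v $ 2 * u $ 2" and ?s = "v $ 2 * u $ 1 - v $ 1 * u $ 2"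
  have u: "(u $ 1)\<^sup>2 + (u $ 2)\<^sup>2 = 1" and v: "(v $ 1)\<^sup>2 + (v $ 2)\<^sup>2 = 1"
    using assms by (simp_all add: norm_eq_1_iff_components)
  have "?c\<^sup>2 + ?s\<^sup>2 = ((u $ 1)\<^sup>2 + (u $ 2)\<^sup>2) * ((v $ 1)\<^sup>2 + (v $ 2)\<^sup>2)"
    by (simp add: power2_eq_square algebra_simps)
  then obtain t where t: "?c = cos t" "?s = sin t"
    using u v sincos_total_2pi[of ?c ?s] by auto
  have "turned u t $ 1 = v $ 1 * ((u $ 1)\<^sup>2 + (u $ 2)\<^sup>2)" "turned u t $ 2 = v $ 2 * ((u $ 1)\<^sup>2 + (u $ 2)\<^sup>2)"
    by (simp_all add: turned_nth t[symmetric] power2_eq_square algebra_simps)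
  then have "v = turned u t"
    using u by (simp add: vec_eq_iff forall_2)
  then show ?thesis ..
qed

lemma principal_angle_unique:
  assumes "cos s = cos t" "sin s = sin t" "-pi < s" "s \<le> pi" "-pi < t" "t \<le> pi"
  shows "s = t"
proof -
  have "cos (s - t) = 1"
    using assms(1,2) by (simp add: cos_diff flip: power2_eq_square)
  then obtain n :: int where n: "s - t = of_int n * 2 * pi"
    by (auto simp: cos_one_2pi_int)
  have "\<bar>of_int n * 2 * pi\<bar> < 2 * pi"
    using assms(3-6) unfolding n[symmetric] by auto
  then have "\<bar>of_int n :: real\<bar> < 1" by (simp add: abs_mult)
  then have "n = 0" by linarith
  then show ?thesis using n by simp
qed

text \<open>This includes that the definite description defining \<^const>\<open>oriented_angle\<close> denotes.\<close>

lemma turned_oriented_angle: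
  assumes "norm u = 1" "norm v = 1"
  shows "turned u (oriented_angle u v) = v"
proof -
  obtain t where t: "v = turned u t" using turned_range[OF assms] by blast
  obtain w where w: "-pi < w" "w \<le> pi" "sin w = sin t" "cos w = cos t"
    using sincos_principal_value by blast
  have "oriented_angle u v = w"
    unfolding oriented_angle_def turned_def[symmetric] t
    using w assms by (intro the_equality) (auto simp: turned_eq_iff intro: principal_angle_unique)
  then show ?thesis using t w by (simp add: turned_def)
qed

lemma continuous_on_turned [continuous_intros]:
  fixes f :: "real \<Rightarrow> real"
  shows "continuous_on S f \<Longrightarrow> continuous_on S (\<lambda>s. turned u (f s))"
  unfolding turned_def by (auto intro!: continuous_intros)

lemma has_vector_derivative_turned:
  assumes "(f has_real_derivative f') (at s within S)"
  shows "((\<lambda>s. turned u (f s)) has_vector_derivative f' *\<^sub>R turned u (f s + pi / 2)) (at s within S)"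
  unfolding turned_def
  by (rule derivative_eq_intros assms refl)+ (simp add: sin_add cos_add algebra_simps)

lemma has_vector_derivative_const_add:
  "(f has_vector_derivative f') F \<Longrightarrow> ((\<lambda>s. c + f s) has_vector_derivative f') F"
  using has_vector_derivative_add[OF has_vector_derivative_const[of c F], of f f'] by simp

text \<open>Along an arc of radius $R$ the unit tangent rotates at the constant rate $\pm 1/R$.\<close>

lemma arc_velocity:
  assumes "circular_arc_on a b X R" "a < b" "R \<noteq> 0" "{a..b} \<subseteq> I"
    and V: "\<And>s. s \<in> I \<Longrightarrow> (X has_vector_derivative V s) (at s within I)"
  shows "\<exists>\<epsilon>\<in>{1, -1}. \<forall>s\<in>{a..b}. V s = turned (V a) (\<epsilon> * (s - a) / R)"
proof -
  define e :: "real^2" where "e = vector [1, 0]"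
  have e: "vector [cos t, sin t] = turned e t" for t
    by (simp add: vec_eq_iff forall_2 turned_nth e_def)
  obtain C \<theta> \<epsilon> where \<epsilon>: "\<epsilon> \<in> {1, -1}"
    and X: "\<And>s. s \<in> {a..b} \<Longrightarrow> X s = C + R *\<^sub>R turned e (\<theta> + \<epsilon> * (s - a) / R)"
    using assms(1) unfolding circular_arc_on_def e by blast
  have V': "V s = turned (\<epsilon> *\<^sub>R turned e (\<theta> + pi / 2)) (\<epsilon> * (s - a) / R)" if s: "s \<in> {a..b}" for s
  proof -
    have D: "((\<lambda>s. \<theta> + \<epsilon> * (s - a) / R) has_real_derivative \<epsilon> / R) (at s within {a..b})"
      using assms(3) by (auto intro!: derivative_eq_intros)
    have "((\<lambda>s. C + R *\<^sub>R turned e (\<theta> + \<epsilon> * (s - a) / R)) has_vector_derivative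
        R *\<^sub>R ((\<epsilon> / R) *\<^sub>R turned e (\<theta> + \<epsilon> * (s - a) / R + pi / 2))) (at s within {a..b})"
      using bounded_linear.has_vector_derivative[OF bounded_linear_scaleR_right
          has_vector_derivative_turned[OF D]]
      by (rule has_vector_derivative_const_add)
    then have "(X has_vector_derivative
        R *\<^sub>R ((\<epsilon> / R) *\<^sub>R turned e (\<theta> + \<epsilon> * (s - a) / R + pi / 2))) (at s within {a..b})"
      using s X by (rule_tac has_vector_derivative_transform) auto
    moreover have "(X has_vector_derivative V s) (at s within {a..b})"
      using V s assms(4) by (blast intro: has_vector_derivative_within_subset)
    ultimately have "V s = R *\<^sub>R ((\<epsilon> / R) *\<^sub>R turned e (\<theta> + \<epsilon> * (s - a) / R + pi / 2))"
      using assms(2) s vector_derivative_unique_within_closed_interval[of a b s X] by auto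
    also have "\<dots> = \<epsilon> *\<^sub>R turned (turned e (\<theta> + pi / 2)) (\<epsilon> * (s - a) / R)"
      using assms(3) by (simp add: turned_turned add_ac)
    also have "\<dots> = turned (\<epsilon> *\<^sub>R turned e (\<theta> + pi / 2)) (\<epsilon> * (s - a) / R)"
      by (simp add: vec_eq_iff forall_2 turned_nth algebra_simps)
    finally show ?thesis .
  qed
  show ?thesis
    using \<epsilon> V'[of a] V' assms(2) by (intro bexI[of _ \<epsilon>]) auto
qed

lemma segment_velocity:
  assumes "segment_on a b X" "a < b" "{a..b} \<subseteq> I"
    and V: "\<And>s. s \<in> I \<Longrightarrow> (X has_vector_derivative V s) (at s within I)"
  shows "\<exists>u. \<forall>s\<in>{a..b}. V s = u"
proof -
  obtain Q u where X: "\<And>s. s \<in> {a..b} \<Longrightarrow> X s = Q + (s - a) *\<^sub>R u"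
    using assms(1) unfolding segment_on_def by blast
  have "V s = u" if s: "s \<in> {a..b}" for s
  proof -
    have "((\<lambda>s. Q + (s - a) *\<^sub>R u) has_vector_derivative u) (at s within {a..b})"
      by (auto intro!: derivative_eq_intros)
    then have "(X has_vector_derivative u) (at s within {a..b})"
      using s X by (rule_tac has_vector_derivative_transform) auto
    moreover have "(X has_vector_derivative V s) (at s within {a..b})"
      using V s assms(3) by (blast intro: has_vector_derivative_within_subset)
    ultimately show "V s = u"
      using assms(2) s vector_derivative_unique_within_closed_interval[of a b s X] by auto
  qed
  then show ?thesis by blast
qed

section \<open>Curves whose tangent angle is a ramp\<close>

text \<open>The tangent angle of a segment of length $p$, a left-turning arc of radius $R$ and angle $w$, and a
  segment, as a function of arc length: it is $0$ up to $p$, increases with slope $1/R$ on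
  $[p, p + R w]$, and is $w$ from there on.\<close>

definition ramp :: "real \<Rightarrow> real \<Rightarrow> real \<Rightarrow> real \<Rightarrow> real" where
  "ramp p R w s = max 0 (min w ((s - p) / R))"

text \<open>The unit tangent of such a curve with initial direction \<open>u\<close>.\<close>

definition ramp_velocity :: "real^2 \<Rightarrow> real \<Rightarrow> real \<Rightarrow> real \<Rightarrow> real \<Rightarrow> real^2" where
  "ramp_velocity u p R w s = turned u (ramp p R w s)"

text \<open>Its piecewise derivative. The value $0$ at the two junctions $p$ and $p + R w$ is an arbitrary
  choice.\<close>

definition ramp_accel :: "real^2 \<Rightarrow> real \<Rightarrow> real \<Rightarrow> real \<Rightarrow> real \<Rightarrow> real^2" where
  "ramp_accel u p R w s =
     (if s \<in> {p<..<p + R * w} then (1 / R) *\<^sub>R turned u ((s - p) / R + pi / 2) else 0)"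

text \<open>The curve of length $L$ that starts at $A$ and has this unit tangent, as an extensional function.
  Defining it as a primitive makes it $C^1$ at the junctions without further argument.\<close>

definition ramp_curve :: "real^2 \<Rightarrow> real^2 \<Rightarrow> real \<Rightarrow> real \<Rightarrow> real \<Rightarrow> real \<Rightarrow> curve" where
  "ramp_curve A u p R w L = (L, restrict (\<lambda>s. A + integral {0..s} (ramp_velocity u p R w)) {0..L})"

lemma ramp_eqs:
  assumes "0 < R" "0 \<le> w"
  shows "s \<le> p \<Longrightarrow> ramp p R w s = 0"
    "p \<le> s \<Longrightarrow> s \<le> p + R * w \<Longrightarrow> ramp p R w s = (s - p) / R"
    "p + R * w \<le> s \<Longrightarrow> ramp p R w s = w"
proof -
  show "ramp p R w s = 0" if "s \<le> p"
  proof -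
    have "(s - p) / R \<le> 0" using that assms by (intro divide_nonpos_pos) auto
    then show ?thesis using assms by (auto simp: ramp_def)
  qed
  show "p \<le> s \<Longrightarrow> s \<le> p + R * w \<Longrightarrow> ramp p R w s = (s - p) / R"
    using assms by (simp add: ramp_def pos_divide_le_eq algebra_simps)
  show "p + R * w \<le> s \<Longrightarrow> ramp p R w s = w"
    using assms by (simp add: ramp_def pos_le_divide_eq algebra_simps)
qed

lemma continuous_on_ramp: "0 < R \<Longrightarrow> continuous_on S (ramp p R w)"
  unfolding ramp_def by (auto intro!: continuous_intros)

lemma continuous_on_ramp_velocity: "0 < R \<Longrightarrow> continuous_on S (ramp_velocity u p R w)"
  unfolding ramp_velocity_def by (intro continuous_intros continuous_on_ramp)

lemma mono_ramp: "0 < R \<Longrightarrow> mono_on S (ramp p R w)"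
  unfolding ramp_def by (intro mono_onI max.mono min.mono divide_right_mono) auto

text \<open>The vector on the left is the chord of an arc of radius $1$ and angle $w$ that starts in the
  direction $u$. The triangle formed by the chord and the two end tangents is isosceles with sides
  $\tan(w/2)$.\<close>

lemma tan_half_identity:
  assumes "0 < w" "w < pi"
  shows "turned u (w - pi / 2) - turned u (- pi / 2) = tan (w / 2) *\<^sub>R (u + turned u w)"
proof -
  define h where "h = w / 2"
  have w: "w = 2 * h" by (simp add: h_def)
  have "0 < cos h" using assms by (intro cos_gt_zero_pi) (auto simp: h_def)
  then have t: "tan h * cos h = sin h" by (simp add: tan_def)
  have "tan h * (1 + cos w) = 2 * (tan h * cos h) * cos h"
    by (simp add: w cos_double_cos power2_eq_square)
  then have "tan h * (1 + cos w) = sin w"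
    unfolding t by (simp add: w sin_double)
  moreover have "tan h * sin w = 2 * (tan h * cos h) * sin h"
    by (simp add: w sin_double)
  then have "tan h * sin w = 1 - cos w"
    unfolding t by (simp add: w cos_double_sin power2_eq_square)
  ultimately have e: "sin w *\<^sub>R u + (1 - cos w) *\<^sub>R rot90 u
      = tan h *\<^sub>R ((1 + cos w) *\<^sub>R u + sin w *\<^sub>R rot90 u)"
    by (simp only: scaleR_add_right scaleR_scaleR)
  have "turned u (w - pi / 2) - turned u (- pi / 2) = sin w *\<^sub>R u + (1 - cos w) *\<^sub>R rot90 u"
    by (simp add: turned_def sin_diff cos_diff algebra_simps)
  also have "\<dots> = tan h *\<^sub>R (u + turned u w)"
    by (subst e) (simp add: turned_def algebra_simps)
  finally show ?thesis by (simp add: h_def)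
qed

lemma ramp_velocity_integral_const:
  assumes "a \<le> b" "\<And>s. s \<in> {a..b} \<Longrightarrow> ramp p R w s = \<phi>"
  shows "(ramp_velocity u p R w has_integral (b - a) *\<^sub>R turned u \<phi>) {a..b}"
  using has_integral_const_real[of "turned u \<phi>" a b] assms
  by (subst has_integral_cong[where g = "\<lambda>_. turned u \<phi>"]) (auto simp: ramp_velocity_def)

lemma ramp_velocity_integral_arc:
  assumes "0 < R" "0 \<le> w" "p \<le> s" "s \<le> p + R * w"
  shows "(ramp_velocity u p R w has_integral
     R *\<^sub>R (turned u ((s - p) / R - pi / 2) - turned u (- pi / 2))) {p..s}"
proof -
  let ?F = "\<lambda>r. R *\<^sub>R turned u ((r - p) / R - pi / 2)"
  have "(?F has_vector_derivative ramp_velocity u p R w r) (at r within {p..s})" if "r \<in> {p..s}" for r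
  proof -
    have D: "((\<lambda>r. (r - p) / R - pi / 2) has_real_derivative 1 / R) (at r within {p..s})"
      using assms(1) by (auto intro!: derivative_eq_intros)
    show ?thesis
      using bounded_linear.has_vector_derivative[OF bounded_linear_scaleR_right
          has_vector_derivative_turned[OF D], of R u] assms that ramp_eqs(2)[of R w p r]
      by (simp add: ramp_velocity_def)
  qed
  from fundamental_theorem_of_calculus[OF assms(3) this] show ?thesis
    by (simp add: scaleR_diff_right)
qed

lemma ramp_velocity_integral:
  assumes "0 < R" "0 < w" "w < pi" "0 \<le> p" "p + R * w \<le> L"
  shows "(ramp_velocity u p R w has_integral
    (p + R * tan (w / 2)) *\<^sub>R u + (R * tan (w / 2) + (L - p - R * w)) *\<^sub>R turned u w) {0..L}"
proof -
  let ?q = "p + R * w"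
  have "p \<le> ?q" using assms by simp
  note i1 = ramp_velocity_integral_const[of 0 p p R w 0 u, OF assms(4)]
  note i2 = ramp_velocity_integral_arc[of R w p ?q u]
  note i3 = ramp_velocity_integral_const[of ?q L p R w w u, OF assms(5)]
  have "(ramp_velocity u p R w has_integral
      ((p - 0) *\<^sub>R turned u 0 + R *\<^sub>R (turned u ((?q - p) / R - pi / 2) - turned u (- pi / 2)))
      + (L - ?q) *\<^sub>R turned u w) {0..L}"
  proof (rule has_integral_combine[of 0 ?q L])
    show "(ramp_velocity u p R w has_integral ((p - 0) *\<^sub>R turned u 0
        + R *\<^sub>R (turned u ((?q - p) / R - pi / 2) - turned u (- pi / 2)))) {0..?q}"
      by (rule has_integral_combine[of 0 p ?q, OF assms(4) \<open>p \<le> ?q\<close>]; (rule i1 i2)?)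
        (use assms ramp_eqs(1)[of R w _ p] in auto)
    show "(ramp_velocity u p R w has_integral (L - ?q) *\<^sub>R turned u w) {?q..L}"
      by (rule i3) (use assms ramp_eqs(3)[of R w p] in auto)
  qed (use assms in auto)
  moreover have "(?q - p) / R - pi / 2 = w - pi / 2" using assms by simp
  ultimately show ?thesis
    using tan_half_identity[OF assms(2,3), of u] by (simp add: algebra_simps)
qed

lemma ramp_curve_velocity:
  assumes "0 < R" "s \<in> {0..L}"
  shows "(snd (ramp_curve A u p R w L) has_vector_derivative ramp_velocity u p R w s) (at s within {0..L})"
proof -
  have "((\<lambda>s. A + integral {0..s} (ramp_velocity u p R w)) has_vector_derivative ramp_velocity u p R w s)
      (at s within {0..L})"
    using integral_has_vector_derivative[OF continuous_on_ramp_velocity[OF assms(1)] assms(2)]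
    by (rule has_vector_derivative_const_add)
  then show ?thesis
    by (rule has_vector_derivative_transform[OF assms(2), rotated]) (simp add: ramp_curve_def)
qed

text \<open>A curve is determined by its starting point and its velocity.\<close>

lemma eq_ramp_curve:
  assumes "0 < R" "X \<in> extensional {0..L}"
    and V: "\<And>s. s \<in> {0..L} \<Longrightarrow> (X has_vector_derivative ramp_velocity u p R w s) (at s within {0..L})"
  shows "(L, X) = ramp_curve (X 0) u p R w L"
proof -
  have eq: "X s = X 0 + integral {0..s} (ramp_velocity u p R w)" if s: "s \<in> {0..L}" for s
  proof -
    have "(ramp_velocity u p R w has_integral (X s - X 0)) {0..s}"
      using s by (intro fundamental_theorem_of_calculus has_vector_derivative_within_subset[OF V]) auto
    then show ?thesis by (simp add: integral_unique)
  qed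
  have "X = restrict (\<lambda>s. X 0 + integral {0..s} (ramp_velocity u p R w)) {0..L}"
  proof
    fix s
    show "X s = restrict (\<lambda>s. X 0 + integral {0..s} (ramp_velocity u p R w)) {0..L} s"
    proof (cases "s \<in> {0..L}")
      case True
      then show ?thesis by (simp only: restrict_apply if_True eq[symmetric])
    next
      case False
      then show ?thesis using extensional_arb[OF assms(2) False] by (simp only: restrict_apply if_False)
    qed
  qed
  then show ?thesis
    by (simp add: ramp_curve_def)
qed

lemma ramp_accel_measurable: "ramp_accel u p R w \<in> borel_measurable (lebesgue_on I)"
proof -
  have "(\<lambda>s. (1 / R) *\<^sub>R turned u ((s - p) / R + pi / 2)) \<in> borel_measurable borel"
    unfolding divide_inverse by (intro borel_measurable_continuous_onI continuous_intros)
  then have "ramp_accel u p R w \<in> borel_measurable borel"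
    unfolding ramp_accel_def by (intro measurable_If) auto
  then show ?thesis
    by (intro measurable_restrict_space1 measurable_completion) simp
qed

lemma ramp_velocity_deriv:
  assumes "0 < R" "0 < w" "s \<notin> {p, p + R * w}"
  shows "(ramp_velocity u p R w has_vector_derivative ramp_accel u p R w s) (at s)"
proof -
  consider "s < p" | "p < s" "s < p + R * w" | "p + R * w < s" using assms(3) by fastforce
  then show ?thesis
  proof cases
    case 1
    have "((\<lambda>s. turned u 0) has_vector_derivative 0) (at s)" by simp
    then have "(ramp_velocity u p R w has_vector_derivative 0) (at s)"
      by (rule has_vector_derivative_transform_within_open[of _ _ _ "{..<p}"])
        (use 1 assms ramp_eqs(1) in \<open>auto simp: ramp_velocity_def\<close>)
    then show ?thesis using 1 by (simp add: ramp_accel_def)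
  next
    case 2
    have "((\<lambda>s. (s - p) / R) has_real_derivative 1 / R) (at s)"
      using assms(1) by (auto intro!: derivative_eq_intros)
    from has_vector_derivative_turned[OF this]
    have "(ramp_velocity u p R w has_vector_derivative (1 / R) *\<^sub>R turned u ((s - p) / R + pi / 2)) (at s)"
      by (rule has_vector_derivative_transform_within_open[of _ _ _ "{p<..<p + R * w}"])
        (use 2 assms ramp_eqs(2)[of R w p] in \<open>auto simp: ramp_velocity_def\<close>)
    then show ?thesis using 2 by (simp add: ramp_accel_def)
  next
    case 3
    have "((\<lambda>s. turned u w) has_vector_derivative 0) (at s)" by simp
    then have "(ramp_velocity u p R w has_vector_derivative 0) (at s)"
      by (rule has_vector_derivative_transform_within_open[of _ _ _ "{p + R * w<..}"])
        (use 3 assms ramp_eqs(3)[of R w p] in \<open>auto simp: ramp_velocity_def\<close>)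
    then show ?thesis using 3 by (simp add: ramp_accel_def)
  qed
qed

lemma norm_ramp_accel:
  assumes "0 < R" "norm u = 1"
  shows "norm (ramp_accel u p R w s) = (if s \<in> {p<..<p + R * w} then 1 / R else 0)"
  using assms by (simp add: ramp_accel_def)

lemma ramp_weak_derivatives:
  assumes "0 < R" "0 < w" "norm u = 1" "0 < L"
    and V: "\<And>s. s \<in> {0..L} \<Longrightarrow> (X has_vector_derivative ramp_velocity u p R w s) (at s within {0..L})"
  shows "weak_derivative 1 {0<..<L} X (ramp_velocity u p R w)"
    "weak_derivative 2 {0<..<L} X (ramp_accel u p R w)"
proof -
  note * = weak_derivatives_piecewise_C2[where S = "{p, p + R * w}" and C = "1 / R",
      OF assms(4) _ V continuous_on_ramp_velocity[OF assms(1)]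
      ramp_velocity_deriv[OF assms(1,2)] ramp_accel_measurable]
  show "weak_derivative 1 {0<..<L} X (ramp_velocity u p R w)"
    by (rule *(1)) (use assms in \<open>auto simp: norm_ramp_accel\<close>)
  show "weak_derivative 2 {0<..<L} X (ramp_accel u p R w)"
    by (rule *(2)) (use assms in \<open>auto simp: norm_ramp_accel\<close>)
qed

lemma Linf_norm_ramp_accel:
  assumes "0 < R" "0 < w" "norm u = 1" "0 \<le> p" "p + R * w \<le> L"
  shows "Linf_norm {0<..<L} (ramp_accel u p R w) = ennreal (1 / R)"
proof -
  let ?M = "lebesgue_on {0<..<L}" and ?f = "\<lambda>s. ennreal (norm (ramp_accel u p R w s))"
  have m: "?f \<in> borel_measurable ?M"
    by (rule measurable_compose[OF ramp_accel_measurable]) measurable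
  have "esssup ?M ?f \<le> ennreal (1 / R)"
    using m assms by (intro esssup_I) (auto simp: norm_ramp_accel)
  \<comment> \<open>The norm is $1/R$ on the arc, which has positive measure.\<close>
  moreover have "\<not> esssup ?M ?f < ennreal (1 / R)"
  proof
    assume less: "esssup ?M ?f < ennreal (1 / R)"
    have "AE s in ?M. ?f s \<le> esssup ?M ?f" by (rule esssup_AE)
    then have "AE s in lebesgue. s \<in> {0<..<L} \<longrightarrow> ?f s \<le> esssup ?M ?f"
      by (subst (asm) AE_restrict_space_iff) auto
    then have "AE s in lebesgue. s \<notin> {p<..<p + R * w}"
    proof eventually_elim
      case (elim s)
      show ?case
      proof
        assume "s \<in> {p<..<p + R * w}"
        moreover from this have "s \<in> {0<..<L}" using assms by auto
        ultimately have "ennreal (1 / R) \<le> esssup ?M ?f"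
          using elim assms by (simp add: norm_ramp_accel)
        then show False using less by simp
      qed
    qed
    then have "{p<..<p + R * w} \<in> null_sets lebesgue"
      by (subst (asm) AE_iff_null_sets[symmetric]) auto
    then show False
      using assms by (auto simp: null_sets_def)
  qed
  ultimately show ?thesis
    unfolding Linf_norm_def by (simp add: antisym)
qed

lemma Linf_bounded:
  fixes f :: "real \<Rightarrow> 'a::euclidean_space"
  assumes "f \<in> borel_measurable (lebesgue_on I)" "\<And>s. s \<in> I \<Longrightarrow> norm (f s) \<le> C"
  shows "f \<in> Linf I"
proof -
  have "Linf_norm I f \<le> ennreal C"
    unfolding Linf_norm_def
    by (intro esssup_I measurable_compose[OF assms(1)] AE_I2) (auto intro: ennreal_leI assms)
  then have "Linf_norm I f < \<infinity>"
    by (rule order.strict_trans1) simp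
  then show ?thesis using assms(1) by (simp add: Linf_def)
qed

lemma second_derivative_norm_ramp_curve:
  assumes "0 < R" "0 < w" "norm u = 1" "0 \<le> p" "p + R * w \<le> L"
  shows "second_derivative_norm (ramp_curve A u p R w L) (1 / R)"
proof -
  have L: "0 < L" using assms mult_pos_pos[of R w] by linarith
  let ?X = "snd (ramp_curve A u p R w L)"
  have *: "weak_derivative 2 {0<..<L} ?X (ramp_accel u p R w)"
    by (rule ramp_weak_derivatives(2)[OF assms(1-3) L ramp_curve_velocity[OF assms(1)]])
  have "Linf_norm {0<..<L} g = ennreal (1 / R)" if "weak_derivative 2 {0<..<L} ?X g" for g
    using Linf_norm_cong_AE[OF ramp_accel_measurable _ weak_derivative_unique[OF * that]]
      Linf_norm_ramp_accel[OF assms] by simp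
  then show ?thesis
    by (simp add: second_derivative_norm_def ramp_curve_def)
qed

lemma ramp_curve_W_inf:
  assumes "0 < R" "0 < w" "norm u = 1" "0 < L"
  shows "snd (ramp_curve A u p R w L) \<in> W_inf 2 {0<..<L}"
proof -
  let ?X = "snd (ramp_curve A u p R w L)"
  note V = ramp_curve_velocity[OF assms(1)]
  note D = ramp_weak_derivatives[OF assms V]
  have Xc: "continuous_on {0..L} ?X"
    using V by (rule continuous_on_vector_derivative)
  then have "bounded (?X ` {0..L})"
    by (intro compact_imp_bounded compact_continuous_image) auto
  then obtain C where "\<forall>s\<in>{0..L}. norm (?X s) \<le> C" by (auto simp: bounded_iff)
  then have X: "?X \<in> Linf {0<..<L}"
    by (intro Linf_bounded[where C = C] continuous_imp_measurable_on_sets_lebesgue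
        continuous_on_subset[OF Xc]) auto
  have "ramp_velocity u p R w \<in> Linf {0<..<L}"
    by (intro Linf_bounded[where C = 1] continuous_imp_measurable_on_sets_lebesgue
        continuous_on_ramp_velocity) (use assms in \<open>auto simp: ramp_velocity_def\<close>)
  moreover have "ramp_accel u p R w \<in> Linf {0<..<L}"
    by (intro Linf_bounded[where C = "1 / R"] ramp_accel_measurable)
      (use assms in \<open>auto simp: norm_ramp_accel\<close>)
  ultimately have "\<exists>g\<in>Linf {0<..<L}. weak_derivative j {0<..<L} ?X g" if "j \<in> {1..2}" for j
  proof (cases "j = 1")
    case False
    then have "j = 2" using that by auto
    then show ?thesis using \<open>ramp_accel u p R w \<in> Linf {0<..<L}\<close> D(2) by blast
  qed (use D(1) in blast)
  then show ?thesis
    using X unfolding W_inf_def by auto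
qed

section \<open>Curves formed of an arc and segments\<close>

lemma norm_\<alpha>_dir: "P \<noteq> A \<Longrightarrow> norm (\<alpha>_dir P A) = 1"
  by (simp add: \<alpha>_dir_def dist_norm)

lemma norm_\<beta>_dir: "P \<noteq> B \<Longrightarrow> norm (\<beta>_dir P B) = 1"
  by (simp add: \<beta>_dir_def dist_norm norm_minus_commute)

lemma \<beta>_dir_eq_turned: "P \<noteq> A \<Longrightarrow> P \<noteq> B \<Longrightarrow> \<beta>_dir P B = turned (\<alpha>_dir P A) (\<Omega>_angle P A B)"
  unfolding \<Omega>_angle_def by (simp add: turned_oriented_angle norm_\<alpha>_dir norm_\<beta>_dir)

lemma displacement_eq:
  "P \<noteq> A \<Longrightarrow> P \<noteq> B \<Longrightarrow> B - A = dist P A *\<^sub>R \<alpha>_dir P A + dist P B *\<^sub>R \<beta>_dir P B"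
  by (simp add: \<alpha>_dir_def \<beta>_dir_def)

lemma turned_independent:
  assumes "norm u = 1" "sin w \<noteq> 0" "x *\<^sub>R u + y *\<^sub>R turned u w = x' *\<^sub>R u + y' *\<^sub>R turned u w"
  shows "x = x'" "y = y'"
proof -
  have n: "(u $ 1)\<^sup>2 + (u $ 2)\<^sup>2 = 1" using assms(1) by (simp add: norm_eq_1_iff_components)
  define d e where "d = x - x'" and "e = y - y'"
  have "d *\<^sub>R u + e *\<^sub>R turned u w = 0"
    using assms(3) by (simp add: d_def e_def algebra_simps)
  then have "(d + e * cos w) *\<^sub>R u + (e * sin w) *\<^sub>R rot90 u = 0"
    by (simp add: turned_def algebra_simps)
  then have *: "(d + e * cos w) * u $ 1 - (e * sin w) * u $ 2 = 0"
      "(d + e * cos w) * u $ 2 + (e * sin w) * u $ 1 = 0"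
    by (simp_all add: vec_eq_iff forall_2)
  have "e * sin w = 0" using * n by algebra
  then have "e = 0" using assms(2) by simp
  moreover have "d + e * cos w = 0" using * n by algebra
  ultimately show "x = x'" "y = y'" by (simp_all add: d_def e_def)
qed

text \<open>From here on, \<open>a\<close> and \<open>b\<close> are the distances $OA$ and $OB$, \<open>w\<close> is the angle $\Omega$,
  \<open>u\<close> is $\vec\alpha$, and \<open>T\<close> is $\tan(\Omega/2)$.\<close>

context
  fixes P A B :: "real^2" and a b w T :: real and u :: "real^2"
  assumes PA: "P \<noteq> A" and PB: "P \<noteq> B" and ang: "0 < \<Omega>_angle P A B" "\<Omega>_angle P A B < pi"
  defines "a \<equiv> dist P A" and "b \<equiv> dist P B" and "w \<equiv> \<Omega>_angle P A B"
    and "u \<equiv> \<alpha>_dir P A" and "T \<equiv> tan (\<Omega>_angle P A B / 2)"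
begin

lemma triangle_facts: "0 < a" "0 < b" "0 < w" "w < pi" "norm u = 1" "0 < T" "0 < sin w"
  "\<beta>_dir P B = turned u w" "B - A = a *\<^sub>R u + b *\<^sub>R turned u w"
proof -
  show "\<beta>_dir P B = turned u w"
    using \<beta>_dir_eq_turned[OF PA PB] by (simp add: u_def w_def)
  then show "B - A = a *\<^sub>R u + b *\<^sub>R turned u w"
    using displacement_eq[OF PA PB] by (simp add: u_def a_def b_def)
qed (use PA PB ang norm_\<alpha>_dir[OF PA] in \<open>simp_all add: a_def b_def w_def u_def T_def sin_gt_zero tan_gt_zero\<close>)

lemma curves_has_velocity:
  assumes "(L, X) \<in> curves P A B" "s \<in> {0..L}"
  shows "(X has_vector_derivative velocity (L, X) s) (at s within {0..L})"
  using assms by (auto simp: curves_def velocity_def differentiable_on_def simp flip: vector_derivative_works)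

text \<open>A curve that consists of an arc shorter than a half circle, possibly preceded and followed by
  segments, is a \<^const>\<open>ramp_curve\<close> whose parameters satisfy the two end point equations. The
  cases $p = 0$ and $q = L$ cover the curves without the first or without the last segment.\<close>

lemma pieces_eq_ramp_curve:
  assumes c: "(L, X) \<in> curves P A B" and pq: "0 \<le> p" "p < q" "q \<le> L"
    and seg1: "0 < p \<Longrightarrow> segment_on 0 p X" and arc: "short_arc_on p q X R"
    and seg2: "q < L \<Longrightarrow> segment_on q L X"
  shows "q = p + R * w" "(L, X) = ramp_curve A u p R w L" "p + R * T = a" "R * T + (L - q) = b"
proof -
  let ?V = "velocity (L, X)"
  note V = curves_has_velocity[OF c]
  have X0: "X 0 = A" and XL: "X L = B" and V0: "?V 0 = u" and VL: "?V L = turned u w"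
    and ext: "X \<in> extensional {0..L}"
    using c triangle_facts(8) by (auto simp: curves_def u_def)
  have R: "0 < R" and len: "q - p < R * pi" and circ: "circular_arc_on p q X R"
    using arc by (auto simp: short_arc_on_def)
  have V1: "?V s = u" if "s \<in> {0..p}" for s
  proof (cases "0 < p")
    case True
    have "{0..p} \<subseteq> {0..L}" using pq by auto
    from segment_velocity[OF seg1[OF True] True this V]
    obtain v where v: "\<forall>s\<in>{0..p}. ?V s = v" by (rule exE)
    have "?V s = v" using v that by (rule bspec)
    moreover have "?V 0 = v" by (rule bspec[OF v]) (use True in simp)
    ultimately show ?thesis using V0 by simp
  next
    case False
    then have "s = 0" using that by simp
    then show ?thesis using V0 by simp
  qed
  have V3: "?V s = turned u w" if "s \<in> {q..L}" for s
  proof (cases "q < L")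
    case True
    have "{q..L} \<subseteq> {0..L}" using pq by auto
    from segment_velocity[OF seg2[OF True] True this V]
    obtain v where v: "\<forall>s\<in>{q..L}. ?V s = v" by (rule exE)
    have "?V s = v" using v that by (rule bspec)
    moreover have "?V L = v" by (rule bspec[OF v]) (use True in simp)
    ultimately show ?thesis using VL by simp
  next
    case False
    then have "s = L" using that pq by simp
    then show ?thesis using VL by simp
  qed
  have "R \<noteq> 0" "{p..q} \<subseteq> {0..L}" using R pq by auto
  from arc_velocity[OF circ pq(2) this V]
  obtain \<epsilon> where \<epsilon>: "\<epsilon> \<in> {1, -1}" and "\<forall>s\<in>{p..q}. ?V s = turned (?V p) (\<epsilon> * (s - p) / R)"
    by (rule bexE)
  then have V2: "?V s = turned u (\<epsilon> * (s - p) / R)" if "s \<in> {p..q}" for s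
    using that V1[of p] pq by auto
  have eq: "cos (\<epsilon> * (q - p) / R) = cos w" "sin (\<epsilon> * (q - p) / R) = sin w"
    using V2[of q] V3[of q] pq triangle_facts(5) by (auto simp: turned_eq_iff)
  have t: "0 < (q - p) / R" "(q - p) / R < pi"
    using R pq len by (auto simp: pos_divide_less_eq mult.commute)
  \<comment> \<open>A right-turning arc shorter than a half circle would give $\sin \Omega < 0$.\<close>
  have "\<epsilon> \<noteq> - 1"
  proof
    assume "\<epsilon> = - 1"
    then have "\<epsilon> * (q - p) / R = - ((q - p) / R)"
      by (simp add: minus_divide_left)
    then have "sin w = - sin ((q - p) / R)"
      unfolding eq(2)[symmetric] by (simp only: sin_minus)
    then show False using triangle_facts(7) sin_gt_zero[OF t] by simp
  qed
  then have "\<epsilon> = 1" using \<epsilon> by simp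
  with eq have eq': "cos ((q - p) / R) = cos w" "sin ((q - p) / R) = sin w" by auto
  have "(q - p) / R = w"
    using principal_angle_unique[OF eq'] t triangle_facts(3,4) by auto
  then show q: "q = p + R * w" using R by (simp add: field_simps)
  have Veq: "?V s = ramp_velocity u p R w s" if s: "s \<in> {0..L}" for s
  proof -
    consider "s \<le> p" | "p \<le> s" "s \<le> q" | "q \<le> s" by linarith
    then show ?thesis
    proof cases
      case 1
      then show ?thesis using V1[of s] s R triangle_facts(3) by (simp add: ramp_velocity_def ramp_eqs)
    next
      case 2
      then show ?thesis using V2[of s] R triangle_facts(3) q \<open>\<epsilon> = 1\<close> by (simp add: ramp_velocity_def ramp_eqs)
    next
      case 3
      then show ?thesis using V3[of s] s R triangle_facts(3) q by (simp add: ramp_velocity_def ramp_eqs)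
    qed
  qed
  have Vr: "(X has_vector_derivative ramp_velocity u p R w s) (at s within {0..L})" if "s \<in> {0..L}" for s
    using V[OF that] Veq[OF that] by simp
  show "(L, X) = ramp_curve A u p R w L"
    using eq_ramp_curve[OF R ext Vr] X0 by simp
  have "(ramp_velocity u p R w has_integral (X L - X 0)) {0..L}"
    using pq by (intro fundamental_theorem_of_calculus Vr) auto
  from has_integral_unique[OF this ramp_velocity_integral[OF R triangle_facts(3,4) pq(1)]]
  have "(p + R * T) *\<^sub>R u + (R * T + (L - p - R * w)) *\<^sub>R turned u w = a *\<^sub>R u + b *\<^sub>R turned u w"
    using q pq X0 XL triangle_facts(9) by (simp add: T_def w_def)
  from turned_independent[OF triangle_facts(5) _ this] triangle_facts(7)
  show "p + R * T = a" "R * T + (L - q) = b" by (simp_all add: q)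
qed

lemma ramp_curve_in_curves:
  assumes R: "0 < R" and p: "0 \<le> p" and L: "p + R * w \<le> L"
    and a: "p + R * T = a" and b: "R * T + (L - (p + R * w)) = b"
  shows "ramp_curve A u p R w L \<in> curves P A B"
proof -
  define X where "X = snd (ramp_curve A u p R w L)"
  have X: "X s = A + integral {0..s} (ramp_velocity u p R w)" if "s \<in> {0..L}" for s
    using that by (simp add: X_def ramp_curve_def)
  have L0: "0 < L" using R p L triangle_facts(3) mult_pos_pos[of R w] by linarith
  have D: "(X has_vector_derivative ramp_velocity u p R w s) (at s within {0..L})" if "s \<in> {0..L}" for s
    unfolding X_def by (rule ramp_curve_velocity[OF R that])
  have V: "velocity (L, X) s = ramp_velocity u p R w s" if "s \<in> {0..L}" for s
    unfolding velocity_def using vector_derivative_within_cbox[OF L0] D[OF that] L0 that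
    by (simp add: vector_derivative_within_cbox)
  have "integral {0..L} (ramp_velocity u p R w)
      = (p + R * T) *\<^sub>R u + (R * T + (L - p - R * w)) *\<^sub>R turned u w"
    using ramp_velocity_integral[OF R triangle_facts(3,4) p L] by (simp add: T_def w_def integral_unique)
  also have "\<dots> = B - A" using a b triangle_facts(9) by (simp add: algebra_simps)
  finally have XL: "X L = B" using X[of L] L0 by simp
  have "X 0 = A" using X[of 0] L0 by simp
  have r0: "ramp p R w 0 = 0" and rL: "ramp p R w L = w"
    using ramp_eqs[OF R] triangle_facts(3) p L by auto
  have "\<exists>\<phi>. continuous_on {0..L} \<phi> \<and> \<phi> 0 = 0 \<and> \<phi> L = \<Omega>_angle P A B \<and>
        (\<forall>s\<in>{0..L}. velocity (L, X) s =
           cos (\<phi> s) *\<^sub>R \<alpha>_dir P A + sin (\<phi> s) *\<^sub>R rot90 (\<alpha>_dir P A)) \<and>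
        mono_on {0..L} \<phi>"
  proof (intro exI[of _ "ramp p R w"] conjI ballI)
    show "velocity (L, X) s = cos (ramp p R w s) *\<^sub>R \<alpha>_dir P A
        + sin (ramp p R w s) *\<^sub>R rot90 (\<alpha>_dir P A)" if "s \<in> {0..L}" for s
      using V[OF that] by (simp only: ramp_velocity_def turned_def u_def)
  qed (rule continuous_on_ramp[OF R] mono_ramp[OF R] r0 trans[OF rL meta_eq_to_obj_eq[OF w_def]])+
  moreover have "continuous_on {0..L} (velocity (L, X))"
  proof -
    have "continuous_on {0..L} (velocity (L, X)) \<longleftrightarrow> continuous_on {0..L} (ramp_velocity u p R w)"
      by (rule continuous_on_cong[OF refl V])
    then show ?thesis using continuous_on_ramp_velocity[OF R] by (rule iffD2)
  qed
  moreover have "X differentiable_on {0..L}"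
    unfolding differentiable_on_def by (intro ballI differentiableI_vector[OF D])
  moreover have "X \<in> W_inf 2 {0<..<L}"
    unfolding X_def by (rule ramp_curve_W_inf[OF R triangle_facts(3,5) L0])
  moreover have "X \<in> extensional {0..L}"
    by (simp add: X_def ramp_curve_def)
  moreover have "velocity (L, X) 0 = \<alpha>_dir P A" "velocity (L, X) L = \<beta>_dir P B"
    "\<forall>s\<in>{0..L}. norm (velocity (L, X) s) = 1"
    using V r0 rL L0 triangle_facts(5,8) by (auto simp: ramp_velocity_def u_def)
  ultimately have "(L, X) \<in> curves P A B"
    using L0 XL \<open>X 0 = A\<close> by (simp add: curves_def)
  then show ?thesis by (simp add: X_def ramp_curve_def)
qed

lemma ramp_curve_pieces:
  assumes R: "0 < R" and p: "0 \<le> p" and L: "p + R * w \<le> L"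
  defines "X \<equiv> snd (ramp_curve A u p R w L)"
  shows "segment_on 0 p X" "short_arc_on p (p + R * w) X R" "segment_on (p + R * w) L X"
proof -
  let ?q = "p + R * w" and ?V = "ramp_velocity u p R w"
  have Rw: "0 < R * w" using R triangle_facts(3) by simp
  have X: "X s = A + integral {0..s} ?V" if "s \<in> {0..L}" for s
    using that by (simp add: X_def ramp_curve_def)
  have step: "X t = X s + integral {s..t} ?V" if "0 \<le> s" "s \<le> t" "t \<le> L" for s t
  proof -
    have "integral {0..s} ?V + integral {s..t} ?V = integral {0..t} ?V"
      by (intro Henstock_Kurzweil_Integration.integral_combine that integrable_continuous_real
          continuous_on_ramp_velocity R)
    then show ?thesis using X[of s] X[of t] that by (simp add: add.assoc)
  qed
  show "segment_on 0 p X"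
    unfolding segment_on_def
  proof (intro exI conjI ballI)
    fix s assume s: "s \<in> {0..p}"
    have "(?V has_integral (s - 0) *\<^sub>R turned u 0) {0..s}"
      by (rule ramp_velocity_integral_const) (use s R triangle_facts(3) in \<open>auto simp: ramp_eqs\<close>)
    then show "X s = X 0 + (s - 0) *\<^sub>R u"
      using step[of 0 s] s L Rw by (simp add: integral_unique)
  qed (rule triangle_facts(5))
  show "segment_on ?q L X"
    unfolding segment_on_def
  proof (intro exI conjI ballI)
    fix s assume s: "s \<in> {?q..L}"
    have "(?V has_integral (s - ?q) *\<^sub>R turned u w) {?q..s}"
      by (rule ramp_velocity_integral_const) (use s R triangle_facts(3) in \<open>auto simp: ramp_eqs\<close>)
    then show "X s = X ?q + (s - ?q) *\<^sub>R turned u w"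
      using step[of ?q s] s p Rw by (simp add: integral_unique)
  qed (simp add: triangle_facts(5))
  define e :: "real^2" where "e = vector [1, 0]"
  have e: "vector [cos t, sin t] = turned e t" for t
    by (simp add: vec_eq_iff forall_2 turned_nth e_def)
  have "norm e = 1" by (simp add: norm_eq_1_iff_components e_def)
  from turned_range[OF this triangle_facts(5)] obtain \<theta> where \<theta>: "u = turned e \<theta>"
    by (rule exE)
  have "X s = (X p - R *\<^sub>R turned u (- pi / 2))
      + R *\<^sub>R vector [cos ((\<theta> - pi / 2) + 1 * (s - p) / R), sin ((\<theta> - pi / 2) + 1 * (s - p) / R)]"
    if s: "s \<in> {p..?q}" for s
  proof -
    have "(?V has_integral R *\<^sub>R (turned u ((s - p) / R - pi / 2) - turned u (- pi / 2))) {p..s}"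
      by (rule ramp_velocity_integral_arc) (use s R triangle_facts(3) in auto)
    then have "X s = X p + R *\<^sub>R (turned u ((s - p) / R - pi / 2) - turned u (- pi / 2))"
      using step[of p s] s p L by (simp add: integral_unique)
    moreover have "turned u ((s - p) / R - pi / 2) = turned e ((\<theta> - pi / 2) + 1 * (s - p) / R)"
    proof -
      have "\<theta> + ((s - p) / R - pi / 2) = (\<theta> - pi / 2) + 1 * (s - p) / R" by simp
      then show ?thesis by (simp only: \<theta> turned_turned)
    qed
    ultimately show ?thesis unfolding e by (simp add: algebra_simps)
  qed
  then have "circular_arc_on p ?q X R"
    unfolding circular_arc_on_def
    by (intro exI[of _ "X p - R *\<^sub>R turned u (- pi / 2)"] exI[of _ "\<theta> - pi / 2"]
        bexI[of _ 1] ballI) (assumption | simp)+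
  then show "short_arc_on p ?q X R"
    using R Rw triangle_facts(4) by (simp add: short_arc_on_def)
qed

text \<open>The unique solution has radius $\min(a,b)/\tan(w/2)$ and a segment of length $|a - b|$, which comes
  first if $a > b$ and last if $a < b$.\<close>

lemma canonical_curve:
  obtains c0 R0 where "c0 \<in> curves P A B" "second_derivative_norm c0 (1 / R0)"
    "a = b \<Longrightarrow> formed_of_arc R0 c0"
    "a \<noteq> b \<Longrightarrow> formed_of_arc_and_segment R0 c0"
    "\<And>c R. a = b \<Longrightarrow> c \<in> curves P A B \<Longrightarrow> formed_of_arc R c \<Longrightarrow> c = c0 \<and> R = R0"
    "\<And>c R. c \<in> curves P A B \<Longrightarrow> formed_of_arc_and_segment R c \<Longrightarrow> c = c0 \<and> R = R0"
proof -
  define R0 p0 where "R0 = min a b / T" and "p0 = max (a - b) 0"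
  define L0 where "L0 = p0 + R0 * w + max (b - a) 0"
  define c0 where c0: "c0 = ramp_curve A u p0 R0 w L0"
  have R0: "0 < R0" and p0: "0 \<le> p0" and L0: "p0 + R0 * w \<le> L0" "L0 = p0 + R0 * w + max (b - a) 0"
    using triangle_facts(1,2,6) by (auto simp: R0_def p0_def L0_def)
  have R0T: "R0 * T = min a b" using triangle_facts(6) by (simp add: R0_def)
  have R0w: "0 < R0 * w" using R0 triangle_facts(3) by simp
  have mem: "c0 \<in> curves P A B"
    unfolding c0 by (rule ramp_curve_in_curves[OF R0 p0 L0(1)]) (auto simp: R0T L0(2) p0_def)
  have sdn: "second_derivative_norm c0 (1 / R0)"
    unfolding c0 by (rule second_derivative_norm_ramp_curve[OF R0 triangle_facts(3,5) p0 L0(1)])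
  note pieces = ramp_curve_pieces[OF R0 p0 L0(1), folded c0]
  have c0_pair: "c0 = (L0, snd c0)" by (simp add: c0 ramp_curve_def)
  have f1: "formed_of_arc R0 c0" if "a = b"
    using pieces(2) that by (subst c0_pair) (simp add: formed_of_arc_def L0(2) p0_def)
  have f2: "formed_of_arc_and_segment R0 c0" if "a \<noteq> b"
  proof (cases "a < b")
    case True
    then have "p0 = 0" "R0 * w < L0" using L0(2) by (auto simp: p0_def)
    then show ?thesis
      using pieces(2,3) R0w
      by (subst c0_pair) (auto simp: formed_of_arc_and_segment_def intro!: exI[of _ "R0 * w"])
  next
    case False
    then have "0 < p0" "L0 = p0 + R0 * w" using that L0(2) by (auto simp: p0_def)
    then show ?thesis
      using pieces(1,2) R0w
      by (subst c0_pair) (auto simp: formed_of_arc_and_segment_def intro!: exI[of _ p0])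
  qed
  have uniq: "(L, X) = c0 \<and> R = R0"
    if "(L, X) = ramp_curve A u p R w L" "p + R * T = a" "R * T + (L - (p + R * w)) = b"
      "0 \<le> p" "p + R * w \<le> L" "p = 0 \<or> L = p + R * w" for L X p R
  proof -
    have "R * T = min a b" "p = p0" using that(2-6) by (auto simp: p0_def)
    then have "R = R0" using triangle_facts(6) by (simp add: R0_def field_simps)
    moreover from this have "L = L0" using that(3) \<open>p = p0\<close> R0T L0(2) by auto
    ultimately show ?thesis using that(1) \<open>p = p0\<close> c0 by simp
  qed
  have u1: "c = c0 \<and> R = R0" if ab: "a = b" and c: "c \<in> curves P A B" and f: "formed_of_arc R c"
    for c R
  proof -
    obtain L X where [simp]: "c = (L, X)" by (cases c)
    have L: "0 < L" and arc: "short_arc_on 0 L X R"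
      using c f by (auto simp: curves_def formed_of_arc_def)
    note * = pieces_eq_ramp_curve[of L X 0 L R]
    have f: "L = 0 + R * w" "(L, X) = ramp_curve A u 0 R w L" "0 + R * T = a" "R * T + (L - L) = b"
      by (rule *; use c L arc in simp)+
    have "(L, X) = c0 \<and> R = R0"
      by (rule uniq[OF f(2,3)]) (use f(1,4) L in auto)
    then show ?thesis by simp
  qed
  have u2: "c = c0 \<and> R = R0" if c: "c \<in> curves P A B" and f: "formed_of_arc_and_segment R c"
    for c R
  proof -
    obtain L X where [simp]: "c = (L, X)" by (cases c)
    obtain m where m: "0 < m" "m < L" and
      "short_arc_on 0 m X R \<and> segment_on m L X \<or> segment_on 0 m X \<and> short_arc_on m L X R"
      using f by (auto simp: formed_of_arc_and_segment_def)
    then consider (arc) "short_arc_on 0 m X R" "segment_on m L X"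
      | (seg) "segment_on 0 m X" "short_arc_on m L X R" by blast
    then show ?thesis
    proof cases
      case arc
      note * = pieces_eq_ramp_curve[of L X 0 m R]
      have f: "m = 0 + R * w" "(L, X) = ramp_curve A u 0 R w L" "0 + R * T = a" "R * T + (L - m) = b"
        by (rule *; use c m arc in simp)+
      have "(L, X) = c0 \<and> R = R0"
        by (rule uniq[OF f(2,3)]) (use f(1,4) m in auto)
      then show ?thesis by simp
    next
      case seg
      note * = pieces_eq_ramp_curve[of L X m L R]
      have f: "L = m + R * w" "(L, X) = ramp_curve A u m R w L" "m + R * T = a" "R * T + (L - L) = b"
        by (rule *; use c m seg in simp)+
      have "(L, X) = c0 \<and> R = R0"
        by (rule uniq[OF f(2,3)]) (use f(1,4) m in auto)
      then show ?thesis by simp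
    qed
  qed
  show thesis
    by (rule that[OF mem sdn f1 f2 u1 u2])
qed

end

theorem mainTheorem2:
  fixes P A B :: "real^2"
  assumes "P \<noteq> A" and "P \<noteq> B" and "A \<noteq> B"
    and "\<Omega>_angle P A B \<in> {0<..<pi}"
  shows "(dist P A = dist P B \<longrightarrow>
            (\<exists>!c. c \<in> curves P A B \<and> (\<exists>R. formed_of_arc R c)) \<and>
            (\<exists>!R. \<exists>c\<in>curves P A B. formed_of_arc R c) \<and>
            (\<forall>c\<in>curves P A B. \<forall>R. formed_of_arc R c \<longrightarrow> second_derivative_norm c (1 / R))) \<and>
         (dist P A \<noteq> dist P B \<longrightarrow>
            (\<exists>!c. c \<in> curves P A B \<and> (\<exists>R. formed_of_arc_and_segment R c)) \<and>
            (\<exists>!R. \<exists>c\<in>curves P A B. formed_of_arc_and_segment R c) \<and>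
            (\<forall>c\<in>curves P A B. \<forall>R. formed_of_arc_and_segment R c \<longrightarrow>
               second_derivative_norm c (1 / R)))"
proof -
  have "0 < \<Omega>_angle P A B" "\<Omega>_angle P A B < pi"
    using assms(4) by auto
  then show ?thesis
  proof (rule canonical_curve[OF assms(1,2)])
    fix c0 R0
    assume c0: "c0 \<in> curves P A B" "second_derivative_norm c0 (1 / R0)"
      "dist P A = dist P B \<Longrightarrow> formed_of_arc R0 c0"
      "dist P A \<noteq> dist P B \<Longrightarrow> formed_of_arc_and_segment R0 c0"
      "\<And>c R. dist P A = dist P B \<Longrightarrow> c \<in> curves P A B \<Longrightarrow> formed_of_arc R c \<Longrightarrow> c = c0 \<and> R = R0"
      "\<And>c R. c \<in> curves P A B \<Longrightarrow> formed_of_arc_and_segment R c \<Longrightarrow> c = c0 \<and> R = R0"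
    have unique: "(\<exists>!c. c \<in> curves P A B \<and> (\<exists>R. F R c)) \<and> (\<exists>!R. \<exists>c\<in>curves P A B. F R c) \<and>
        (\<forall>c\<in>curves P A B. \<forall>R. F R c \<longrightarrow> second_derivative_norm c (1 / R))"
      if F: "F R0 c0" and only: "\<And>c R. c \<in> curves P A B \<Longrightarrow> F R c \<Longrightarrow> c = c0 \<and> R = R0"
      for F :: "real \<Rightarrow> curve \<Rightarrow> bool"
    proof (intro conjI ballI allI impI)
      show "\<exists>!c. c \<in> curves P A B \<and> (\<exists>R. F R c)"
      proof (rule ex1I[of _ c0])
        show "c0 \<in> curves P A B \<and> (\<exists>R. F R c0)" using F c0(1) by blast
        show "c = c0" if "c \<in> curves P A B \<and> (\<exists>R. F R c)" for c
          using that only[of c] by blast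
      qed
      show "\<exists>!R. \<exists>c\<in>curves P A B. F R c"
      proof (rule ex1I[of _ R0])
        show "\<exists>c\<in>curves P A B. F R0 c" using F c0(1) by blast
        show "R = R0" if "\<exists>c\<in>curves P A B. F R c" for R
          using that only[of _ R] by blast
      qed
      show "second_derivative_norm c (1 / R)" if "c \<in> curves P A B" "F R c" for c R
        using only[OF that] c0(2) by simp
    qed
    show ?thesis
    proof (rule conjI; rule impI)
      assume eq: "dist P A = dist P B"
      show "(\<exists>!c. c \<in> curves P A B \<and> (\<exists>R. formed_of_arc R c)) \<and>
            (\<exists>!R. \<exists>c\<in>curves P A B. formed_of_arc R c) \<and>
            (\<forall>c\<in>curves P A B. \<forall>R. formed_of_arc R c \<longrightarrow> second_derivative_norm c (1 / R))"
        by (rule unique[of formed_of_arc, OF c0(3)[OF eq] c0(5)[OF eq]])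
    next
      assume neq: "dist P A \<noteq> dist P B"
      show "(\<exists>!c. c \<in> curves P A B \<and> (\<exists>R. formed_of_arc_and_segment R c)) \<and>
            (\<exists>!R. \<exists>c\<in>curves P A B. formed_of_arc_and_segment R c) \<and>
            (\<forall>c\<in>curves P A B. \<forall>R. formed_of_arc_and_segment R c \<longrightarrow>
               second_derivative_norm c (1 / R))"
        by (rule unique[of formed_of_arc_and_segment, OF c0(4)[OF neq] c0(6)])
    qed
  qed
qed

end
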